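(* Let $D$ be an effective divisor on a complex manifold $X$. Then $\mathcal{I}_{k+1,\alpha}(D)\subseteq\mathcal{I}_{k,\alpha}(D)$ for all $\alpha\in\mathbb{Q}$ and $k\in\mathbb{N}$.
   Context: $\mathbb{N}$ includes $0$; all $\mathscr{D}$-modules are right modules. Let $n=\dim X$, $L=\mathcal{O}_X(D)$, $s\in H^0(X,L)$ with $\mathrm{div}(s)=D$, viewed as a closed embedding $s\colon X\to L$ into the total space of the line bundle. Let $(\mathcal{M},F_\bullet\mathcal{M})=s_+(\omega_X,F_\bullet\omega_X)$, where $F_{-n}\omega_X=\omega_X$, $F_{-n-1}\omega_X=0$; then $\mathrm{gr}^F_{-n+k}\mathcal{M}\cong s_*(\omega_X\otimes L^k)$ for $k\ge0$ and $0$ for $k<0$. Let $V_\bullet\mathcal{M}$ be the Kashiwara–Malgrange $V$-filtration along the zero section of $L$ (increasing, indexed by $\mathbb{Q}$, discrete, right-continuous; for a local fiber coordinate $t$: each $V_\alpha\mathcal{M}$ coherent over $V_0\mathscr{D}_L$, the operators preserving the ideal of the zero section; $V_\alpha\mathcal{M}\cdot t\subseteq V_{\alpha-1}\mathcal{M}$ with equality for $\alpha<0$; $V_\alpha\mathcal{M}\cdot\partial_t\subseteq V_{\alpha+1}\mathcal{M}$; $t\partial_t-\alpha$ nilpotent on $V_\alpha\mathcal{M}/V_{<\alpha}\mathcal{M}$). The higher multiplier ideal $\mathcal{I}_{k,\alpha}(D)\subseteq\mathcal{O}_X$ is the unique coherent ideal sheaf with $$\frac{F_{-n+k}\mathcal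 M\cap V_\alpha\mathcal M}{F_{-n+k-1}\mathcal M\cap V_\alpha\mathcal M}=s_*(\omega_X\otimes L^k\otimes\mathcal{I}_{k,\alpha}(D)).$$ *)

theory Defs
  imports
    "HOL-Analysis.Analysis"
    "HOL-Library.Function_Algebras"
    "Jordan_Normal_Form.Determinant"
begin

section \<open>Complex manifolds\<close>

text \<open>As for \<^const>\<open>Euclidean_space\<close>, the space of n complex coordinates is realised inside the
  functions on the natural numbers, so that the dimension is a number (0 included) and a line bundle over
  an n-dimensional manifold can have the fibre coordinate as coordinate number n.\<close>

definition complex_space :: "nat \<Rightarrow> (nat \<Rightarrow> complex) topology" where
  "complex_space n = subtopology (product_topology (\<lambda>i. euclidean) UNIV) {z. \<forall>i\<ge>n. z i = 0}"

text \<open>Holomorphy in several variables: continuous, and holomorphic in each variable separately.\<close>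

definition holomorphic_fun :: "nat \<Rightarrow> (nat \<Rightarrow> complex) set \<Rightarrow> ((nat \<Rightarrow> complex) \<Rightarrow> complex) \<Rightarrow> bool" where
  "holomorphic_fun n \<Omega> f \<longleftrightarrow>
     openin (complex_space n) \<Omega> \<and>
     continuous_map (subtopology (complex_space n) \<Omega>) euclidean f \<and>
     (\<forall>z\<in>\<Omega>. \<forall>i<n. (\<lambda>w. f (z(i := w))) field_differentiable at (z i))"

type_synonym 'a chart = "'a set \<times> ('a \<Rightarrow> nat \<Rightarrow> complex)"

record 'a cmanifold =
  mdim :: nat
  mtop :: "'a topology"
  matlas :: "'a chart set"

definition complex_manifold :: "'a cmanifold \<Rightarrow> bool" where
  "complex_manifold X \<longleftrightarrow>
     Hausdorff_space (mtop X) \<and> second_countable (mtop X) \<and>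
     (\<Union>(U, \<phi>)\<in>matlas X. U) = topspace (mtop X) \<and>
     (\<forall>(U, \<phi>)\<in>matlas X.
        openin (mtop X) U \<and> openin (complex_space (mdim X)) (\<phi> ` U) \<and>
        homeomorphic_map (subtopology (mtop X) U) (subtopology (complex_space (mdim X)) (\<phi> ` U)) \<phi>) \<and>
     (\<forall>(U, \<phi>)\<in>matlas X. \<forall>(U', \<phi>')\<in>matlas X. \<forall>i<mdim X.
        holomorphic_fun (mdim X) (\<phi> ` (U \<inter> U')) (\<lambda>z. \<phi>' (inv_into U \<phi> z) i))"

text \<open>A section over \<open>W\<close> of any of the sheaves below is represented by a total function; its values
  away from \<open>W\<close> are irrelevant, and no condition below depends on them.\<close>

definition structure_sheaf :: "'a cmanifold \<Rightarrow> 'a set \<Rightarrow> ('a \<Rightarrow> complex) set" where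
  "structure_sheaf X W = {f. openin (mtop X) W \<and>
     (\<forall>(U, \<phi>)\<in>matlas X. holomorphic_fun (mdim X) (\<phi> ` (U \<inter> W)) (f \<circ> inv_into U \<phi>))}"

definition chart_deriv :: "'a chart \<Rightarrow> nat \<Rightarrow> ('a \<Rightarrow> complex) \<Rightarrow> 'a \<Rightarrow> complex" where
  "chart_deriv c i f x =
     deriv (\<lambda>w. f (inv_into (fst c) (snd c) ((snd c x)(i := w)))) (snd c x i)"

text \<open>The determinant of the matrix of partial derivatives of the coordinates \<open>c'\<close> with respect to
  the coordinates \<open>c\<close>.\<close>

definition jacobian :: "'a cmanifold \<Rightarrow> 'a chart \<Rightarrow> 'a chart \<Rightarrow> 'a \<Rightarrow> complex" where
  "jacobian X c c' x = Determinant.det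
     (Matrix.mat (mdim X) (mdim X) (\<lambda>(i, j). chart_deriv c j (\<lambda>y. snd c' y i) x))"

section \<open>Effective divisors and line bundles\<close>

text \<open>An effective divisor is given by local equations (on a manifold, Weil and Cartier divisors are
  the same): a local equation is a holomorphic function that vanishes identically on no nonempty
  open set, and two of them differ by a unit.\<close>

definition effective_divisor :: "'a cmanifold \<Rightarrow> ('a set \<times> ('a \<Rightarrow> complex)) set \<Rightarrow> bool" where
  "effective_divisor X D \<longleftrightarrow>
     (\<Union>(U, f)\<in>D. U) = topspace (mtop X) \<and>
     (\<forall>(U, f)\<in>D. f \<in> structure_sheaf X U \<and>
        (\<forall>W. openin (mtop X) W \<and> W \<subseteq> U \<and> W \<noteq> {} \<longrightarrow> (\<exists>x\<in>W. f x \<noteq> 0))) \<and>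
     (\<forall>(U, f)\<in>D. \<forall>(U', f')\<in>D. \<exists>u\<in>structure_sheaf X (U \<inter> U').
        \<forall>x\<in>U \<inter> U'. u x \<noteq> 0 \<and> f' x = u x * f x)"

text \<open>A line bundle is represented by its total space, projection, and local trivialisations
  \<open>(U, \<tau>)\<close>, where \<open>\<tau>\<close> is the linear fibre coordinate over \<open>U\<close>.\<close>

record ('a, 'b) line_bundle =
  lb_base :: "'a cmanifold"
  lb_top :: "'b topology"
  lb_proj :: "'b \<Rightarrow> 'a"
  lb_trivs :: "('a set \<times> ('b \<Rightarrow> complex)) set"

definition over :: "('a, 'b) line_bundle \<Rightarrow> 'a set \<Rightarrow> 'b set" where
  "over L U = {p \<in> topspace (lb_top L). lb_proj L p \<in> U}"

definition holomorphic_line_bundle :: "('a, 'b) line_bundle \<Rightarrow> bool" where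
  "holomorphic_line_bundle L \<longleftrightarrow>
     continuous_map (lb_top L) (mtop (lb_base L)) (lb_proj L) \<and>
     (\<Union>(U, \<tau>)\<in>lb_trivs L. U) = topspace (mtop (lb_base L)) \<and>
     (\<forall>(U, \<tau>)\<in>lb_trivs L. openin (mtop (lb_base L)) U \<and>
        homeomorphic_map (subtopology (lb_top L) (over L U))
          (prod_topology (subtopology (mtop (lb_base L)) U) euclidean)
          (\<lambda>p. (lb_proj L p, \<tau> p))) \<and>
     (\<forall>(U, \<tau>)\<in>lb_trivs L. \<forall>(U', \<tau>')\<in>lb_trivs L.
        \<exists>g\<in>structure_sheaf (lb_base L) (U \<inter> U').
          (\<forall>x\<in>U \<inter> U'. g x \<noteq> 0) \<and>
          (\<forall>p\<in>over L (U \<inter> U'). \<tau>' p = g (lb_proj L p) * \<tau> p))"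

definition total_space :: "('a, 'b) line_bundle \<Rightarrow> 'b cmanifold" where
  "total_space L = \<lparr>mdim = Suc (mdim (lb_base L)), mtop = lb_top L,
     matlas = {(over L (U \<inter> U'), \<lambda>p. (\<phi> (lb_proj L p))(mdim (lb_base L) := \<tau> p)) | U \<phi> U' \<tau>.
                 (U, \<phi>) \<in> matlas (lb_base L) \<and> (U', \<tau>) \<in> lb_trivs L}\<rparr>"

definition holomorphic_section :: "('a, 'b) line_bundle \<Rightarrow> ('a \<Rightarrow> 'b) \<Rightarrow> bool" where
  "holomorphic_section L s \<longleftrightarrow>
     (\<forall>x\<in>topspace (mtop (lb_base L)). s x \<in> topspace (lb_top L) \<and> lb_proj L (s x) = x) \<and>
     (\<forall>(U, \<tau>)\<in>lb_trivs L. \<tau> \<circ> s \<in> structure_sheaf (lb_base L) U)"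

text \<open>\<open>div(s) = D\<close>. A pair of a line bundle and a section with this property is isomorphic, by a
  unique isomorphism, to \<open>O(D)\<close> with its canonical section.\<close>

definition has_divisor ::
  "('a, 'b) line_bundle \<Rightarrow> ('a \<Rightarrow> 'b) \<Rightarrow> ('a set \<times> ('a \<Rightarrow> complex)) set \<Rightarrow> bool" where
  "has_divisor L s D \<longleftrightarrow>
     (\<forall>(U, \<tau>)\<in>lb_trivs L. \<forall>(U', f)\<in>D. \<exists>u\<in>structure_sheaf (lb_base L) (U \<inter> U').
        \<forall>x\<in>U \<inter> U'. u x \<noteq> 0 \<and> \<tau> (s x) = u x * f x)"

text \<open>The vector field \<open>\<partial>\<^sub>t\<close> along the fibres, for a fibre coordinate \<open>t = \<tau>\<close> over \<open>U\<close>.\<close>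

definition fibre_deriv ::
  "('a, 'b) line_bundle \<Rightarrow> 'a set \<Rightarrow> ('b \<Rightarrow> complex) \<Rightarrow> ('b \<Rightarrow> complex) \<Rightarrow> 'b \<Rightarrow> complex" where
  "fibre_deriv L U \<tau> h p =
     deriv (\<lambda>w. h (inv_into (over L U) (\<lambda>q. (lb_proj L q, \<tau> q)) (lb_proj L p, w))) (\<tau> p)"

section \<open>Coherent modules over a sheaf of rings\<close>

text \<open>Right modules over a sheaf of rings \<open>\<A>\<close>. Equality of sections over \<open>Q\<close> is \<open>eqv Q\<close> (for the
  module) and \<open>eqA Q\<close> (for the ring), since sections are given by representatives.\<close>

definition finite_type_module :: "'x topology \<Rightarrow> ('x set \<Rightarrow> 'r set) \<Rightarrow>
    ('m::comm_monoid_add \<Rightarrow> 'r \<Rightarrow> 'm) \<Rightarrow> ('x set \<Rightarrow> 'm \<Rightarrow> 'm \<Rightarrow> bool) \<Rightarrow> ('x set \<Rightarrow> 'm set) \<Rightarrow> bool" where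
  "finite_type_module T \<A> act eqv \<V> \<longleftrightarrow>
     (\<forall>p\<in>topspace T. \<exists>Q (m::nat) b. openin T Q \<and> p \<in> Q \<and> (\<forall>j<m. b j \<in> \<V> Q) \<and>
        (\<forall>Q' v q. openin T Q' \<and> Q' \<subseteq> Q \<and> v \<in> \<V> Q' \<and> q \<in> Q' \<longrightarrow>
           (\<exists>Q'' a. openin T Q'' \<and> q \<in> Q'' \<and> Q'' \<subseteq> Q' \<and> (\<forall>j<m. a j \<in> \<A> Q'') \<and>
              eqv Q'' v (\<Sum>j<m. act (b j) (a j)))))"

definition relations :: "('x set \<Rightarrow> 'r set) \<Rightarrow> ('m::comm_monoid_add \<Rightarrow> 'r \<Rightarrow> 'm) \<Rightarrow>
    ('x set \<Rightarrow> 'm \<Rightarrow> 'm \<Rightarrow> bool) \<Rightarrow> nat \<Rightarrow> (nat \<Rightarrow> 'm) \<Rightarrow> 'x set \<Rightarrow> (nat \<Rightarrow> 'r) set" where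
  "relations \<A> act eqv r v Q = {c. (\<forall>i<r. c i \<in> \<A> Q) \<and> eqv Q (\<Sum>i<r. act (v i) (c i)) 0}"

definition coherent_module :: "'x topology \<Rightarrow> ('x set \<Rightarrow> 'r::comm_monoid_add set) \<Rightarrow>
    ('r \<Rightarrow> 'r \<Rightarrow> 'r) \<Rightarrow> ('x set \<Rightarrow> 'r \<Rightarrow> 'r \<Rightarrow> bool) \<Rightarrow>
    ('m::comm_monoid_add \<Rightarrow> 'r \<Rightarrow> 'm) \<Rightarrow> ('x set \<Rightarrow> 'm \<Rightarrow> 'm \<Rightarrow> bool) \<Rightarrow> ('x set \<Rightarrow> 'm set) \<Rightarrow> bool" where
  "coherent_module T \<A> mul eqA act eqv \<V> \<longleftrightarrow>
     finite_type_module T \<A> act eqv \<V> \<and>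
     (\<forall>Q r v. openin T Q \<and> (\<forall>i<r. v i \<in> \<V> Q) \<longrightarrow>
        finite_type_module (subtopology T Q) \<A> (\<lambda>c a i. mul (c i) a)
          (\<lambda>Q' c c'. \<forall>i<r. eqA Q' (c i) (c' i)) (relations \<A> act eqv r v))"

definition fun_eq_on :: "'a set \<Rightarrow> ('a \<Rightarrow> complex) \<Rightarrow> ('a \<Rightarrow> complex) \<Rightarrow> bool" where
  "fun_eq_on W f g \<longleftrightarrow> (\<forall>x\<in>W. f x = g x)"

definition coherent_ideal_sheaf :: "'a cmanifold \<Rightarrow> ('a set \<Rightarrow> ('a \<Rightarrow> complex) set) \<Rightarrow> bool" where
  "coherent_ideal_sheaf X J \<longleftrightarrow>
     (\<forall>W. openin (mtop X) W \<longrightarrow>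
        J W \<subseteq> structure_sheaf X W \<and> 0 \<in> J W \<and>
        (\<forall>f\<in>J W. \<forall>g\<in>J W. f + g \<in> J W) \<and>
        (\<forall>f\<in>J W. \<forall>a\<in>structure_sheaf X W. f * a \<in> J W) \<and>
        (\<forall>W'. openin (mtop X) W' \<and> W' \<subseteq> W \<longrightarrow> J W \<subseteq> J W') \<and>
        (\<forall>f\<in>structure_sheaf X W.
           (\<forall>x\<in>W. \<exists>W' g. openin (mtop X) W' \<and> x \<in> W' \<and> W' \<subseteq> W \<and> g \<in> J W' \<and> fun_eq_on W' f g)
           \<longrightarrow> f \<in> J W)) \<and>
     coherent_module (mtop X) (structure_sheaf X) (*) fun_eq_on (*) fun_eq_on J"

section \<open>Differential operators\<close>

text \<open>For a holomorphic map \<open>s: X \<rightarrow> Y\<close>, \<open>local_operator Y X s W P\<close> says that \<open>P\<close> is a linear map of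
  sheaves over \<open>W\<close> from the inverse image of the structure sheaf of \<open>Y\<close> to that of \<open>X\<close>: the value
  of \<open>P h\<close> at \<open>x\<close> makes sense when \<open>h\<close> is holomorphic near \<open>s x\<close>, and depends only on its germ there.\<close>

definition local_operator :: "'b cmanifold \<Rightarrow> 'a cmanifold \<Rightarrow> ('a \<Rightarrow> 'b) \<Rightarrow> 'a set \<Rightarrow>
    (('b \<Rightarrow> complex) \<Rightarrow> 'a \<Rightarrow> complex) \<Rightarrow> bool" where
  "local_operator Y X s W P \<longleftrightarrow>
     (\<forall>Q. \<forall>h\<in>structure_sheaf Y Q. P h \<in> structure_sheaf X (W \<inter> s -` Q)) \<and>
     (\<forall>Q. \<forall>h\<in>structure_sheaf Y Q. \<forall>h'\<in>structure_sheaf Y Q.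
        fun_eq_on Q h h' \<longrightarrow> fun_eq_on (W \<inter> s -` Q) (P h) (P h')) \<and>
     (\<forall>Q a b. \<forall>h\<in>structure_sheaf Y Q. \<forall>h'\<in>structure_sheaf Y Q. \<forall>x\<in>W \<inter> s -` Q.
        P (\<lambda>p. a * h p + b * h' p) x = a * P h x + b * P h' x)"

text \<open>Grothendieck's definition of the order: an operator has order less than 0 iff it is zero, and
  order less than \<open>k + 1\<close> iff its commutators with all functions have order less than \<open>k\<close>.\<close>

primrec order_less :: "'b cmanifold \<Rightarrow> ('a \<Rightarrow> 'b) \<Rightarrow> nat \<Rightarrow> 'a set \<Rightarrow>
    (('b \<Rightarrow> complex) \<Rightarrow> 'a \<Rightarrow> complex) \<Rightarrow> bool" where
  "order_less Y s 0 W P \<longleftrightarrow>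
     (\<forall>Q. \<forall>h\<in>structure_sheaf Y Q. \<forall>x\<in>W \<inter> s -` Q. P h x = 0)"
| "order_less Y s (Suc k) W P \<longleftrightarrow>
     (\<forall>Q. \<forall>a\<in>structure_sheaf Y Q.
        order_less Y s k (W \<inter> s -` Q) (\<lambda>h x. P (a * h) x - a (s x) * P h x))"

text \<open>For \<open>s: X \<rightarrow> Y\<close> this is the transfer bimodule \<open>D\<^bsub>X\<rightarrow>Y\<^esub>\<close>, the tensor product of the structure
  sheaf of \<open>X\<close> with the inverse image of \<open>D\<^sub>Y\<close> over that of the structure sheaf of \<open>Y\<close>. For the
  identity map it is the sheaf of differential operators.\<close>

definition diff_operators :: "'b cmanifold \<Rightarrow> 'a cmanifold \<Rightarrow> ('a \<Rightarrow> 'b) \<Rightarrow> 'a set \<Rightarrow>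
    (('b \<Rightarrow> complex) \<Rightarrow> 'a \<Rightarrow> complex) set" where
  "diff_operators Y X s W = {P. openin (mtop X) W \<and> local_operator Y X s W P \<and>
     (\<forall>x\<in>W. \<exists>W' k. openin (mtop X) W' \<and> x \<in> W' \<and> W' \<subseteq> W \<and> order_less Y s k W' P)}"

text \<open>The \<open>j\<close>-th power of the ideal of the zero section. (Preserving the ideal itself is not enough
  to lie in \<open>V\<^sub>0D\<close>, as \<open>t\<partial>\<^sub>t\<^sup>2\<close> shows; all powers have to be preserved.)\<close>

definition zero_section_ideal_power ::
  "('a, 'b) line_bundle \<Rightarrow> nat \<Rightarrow> 'b set \<Rightarrow> ('b \<Rightarrow> complex) set" where
  "zero_section_ideal_power L j Q = {h \<in> structure_sheaf (total_space L) Q.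
     \<forall>(U, \<tau>)\<in>lb_trivs L. \<exists>g\<in>structure_sheaf (total_space L) (Q \<inter> over L U).
       \<forall>p\<in>Q \<inter> over L U. h p = \<tau> p ^ j * g p}"

type_synonym 'b operator = "('b \<Rightarrow> complex) \<Rightarrow> 'b \<Rightarrow> complex"

definition V0_operators :: "('a, 'b) line_bundle \<Rightarrow> 'b set \<Rightarrow> 'b operator set" where
  "V0_operators L Q = {P \<in> diff_operators (total_space L) (total_space L) id Q.
     \<forall>Q' j. openin (lb_top L) Q' \<and> Q' \<subseteq> Q \<longrightarrow>
       P ` zero_section_ideal_power L j Q' \<subseteq> zero_section_ideal_power L j Q'}"

definition operator_eq :: "('a, 'b) line_bundle \<Rightarrow> 'b set \<Rightarrow> 'b operator \<Rightarrow> 'b operator \<Rightarrow> bool" where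
  "operator_eq L Q P P' \<longleftrightarrow>
     (\<forall>Q'. \<forall>h\<in>structure_sheaf (total_space L) Q'. fun_eq_on (Q \<inter> Q') (P h) (P' h))"

section \<open>The direct image of the canonical module\<close>

text \<open>The right module \<open>s\<^sub>+\<omega>\<^sub>X = s\<^sub>*(\<omega>\<^sub>X \<otimes> D\<^bsub>X\<rightarrow>L\<^esub>)\<close>, tensor product over \<open>D\<^sub>X\<close>, is by definition the
  quotient of the tensor product of \<open>\<omega>\<^sub>X\<close> with \<open>D\<^bsub>X\<rightarrow>L\<^esub>\<close> over the structure sheaf by the local sums of
  elements \<open>\<omega>\<xi> \<otimes> P - \<omega> \<otimes> \<xi>P\<close>, with \<open>\<xi>\<close> a vector field.

  The tensor product over the structure sheaf is the sheaf of differential operators \<open>\<Psi>\<close> from the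
  inverse image of the structure sheaf of \<open>L\<close> to \<open>\<omega>\<^sub>X\<close>; an n-form is given by its coefficients
  with respect to \<open>dx\<^sub>1 \<and> ... \<and> dx\<^sub>n\<close> in all charts. A differential operator \<open>P\<close> on \<open>L\<close> acts from the
  right by \<open>\<Psi> \<circ> P\<close>.

  In coordinates \<open>(g dx)\<partial>\<^sub>i = -(\<partial>\<^sub>i g) dx\<close>, so for \<open>\<omega> = g dx\<close> and \<open>\<xi> = a\<partial>\<^sub>i\<close> the element
  \<open>\<omega>\<xi> \<otimes> P - \<omega> \<otimes> \<xi>P\<close> is the operator sending \<open>h\<close> to \<open>-\<partial>\<^sub>i (g a P h) dx\<close>.

  Sections of the quotient are represented by operators \<open>\<Psi>\<close>, with equality \<open>image_eq\<close>, and subsheaves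
  of the quotient by subsheaves of the sheaf of operators that contain the relations.\<close>

type_synonym ('a, 'b) form_operator = "('b \<Rightarrow> complex) \<Rightarrow> 'a chart \<Rightarrow> 'a \<Rightarrow> complex"

definition preim :: "('a, 'b) line_bundle \<Rightarrow> ('a \<Rightarrow> 'b) \<Rightarrow> 'b set \<Rightarrow> 'a set" where
  "preim L s Q = {x \<in> topspace (mtop (lb_base L)). s x \<in> Q}"

definition form_operators ::
  "('a, 'b) line_bundle \<Rightarrow> ('a \<Rightarrow> 'b) \<Rightarrow> 'b set \<Rightarrow> ('a, 'b) form_operator set" where
  "form_operators L s Q = {\<Psi>. openin (lb_top L) Q \<and>
     (\<forall>c\<in>matlas (lb_base L).
        (\<lambda>h. \<Psi> h c) \<in> diff_operators (total_space L) (lb_base L) s (preim L s Q \<inter> fst c)) \<and>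
     (\<forall>Q'. \<forall>h\<in>structure_sheaf (total_space L) Q'.
        \<forall>c\<in>matlas (lb_base L). \<forall>c'\<in>matlas (lb_base L). \<forall>x\<in>preim L s (Q \<inter> Q') \<inter> fst c \<inter> fst c'.
          \<Psi> h c x = jacobian (lb_base L) c c' x * \<Psi> h c' x)}"

definition tensor_relations ::
  "('a, 'b) line_bundle \<Rightarrow> ('a \<Rightarrow> 'b) \<Rightarrow> 'b set \<Rightarrow> ('a, 'b) form_operator set" where
  "tensor_relations L s Q = {\<Psi> \<in> form_operators L s Q.
     \<forall>x\<in>preim L s Q. \<exists>c\<in>matlas (lb_base L). \<exists>W P.
       openin (mtop (lb_base L)) W \<and> x \<in> W \<and> W \<subseteq> preim L s Q \<inter> fst c \<and>
       (\<forall>i<mdim (lb_base L). P i \<in> diff_operators (total_space L) (lb_base L) s W) \<and>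
       (\<forall>Q'. \<forall>h\<in>structure_sheaf (total_space L) Q'. \<forall>y\<in>W \<inter> s -` Q'.
          \<Psi> h c y = (\<Sum>i<mdim (lb_base L). chart_deriv c i (P i h) y))}"

definition image_eq :: "('a, 'b) line_bundle \<Rightarrow> ('a \<Rightarrow> 'b) \<Rightarrow> 'b set \<Rightarrow>
    ('a, 'b) form_operator \<Rightarrow> ('a, 'b) form_operator \<Rightarrow> bool" where
  "image_eq L s Q \<Psi> \<Phi> \<longleftrightarrow> \<Psi> - \<Phi> \<in> tensor_relations L s Q"

text \<open>\<open>F\<^sub>p M\<close> is the image of the sum of all \<open>F\<^sub>q\<omega>\<^sub>X \<otimes> F\<^bsub>p-q\<^esub>D\<^bsub>X\<rightarrow>L\<^esub>\<close>; as \<open>F\<omega>\<^sub>X\<close> jumps only at \<open>-n\<close>, this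
  is the image of the operators of order at most \<open>p + n\<close>.\<close>

definition hodge_filtration ::
  "('a, 'b) line_bundle \<Rightarrow> ('a \<Rightarrow> 'b) \<Rightarrow> int \<Rightarrow> 'b set \<Rightarrow> ('a, 'b) form_operator set" where
  "hodge_filtration L s p Q = {\<Psi> \<in> form_operators L s Q.
     \<forall>q\<in>Q. \<exists>Q'. \<exists>\<Phi>\<in>form_operators L s Q'. q \<in> Q' \<and> Q' \<subseteq> Q \<and>
       (\<forall>c\<in>matlas (lb_base L).
          order_less (total_space L) s (nat (p + int (mdim (lb_base L)) + 1))
            (preim L s Q' \<inter> fst c) (\<lambda>h. \<Phi> h c)) \<and>
       image_eq L s Q' \<Psi> \<Phi>}"

section \<open>The V-filtration\<close>

definition V0_submodule ::
  "('a, 'b) line_bundle \<Rightarrow> ('a \<Rightarrow> 'b) \<Rightarrow> ('b set \<Rightarrow> ('a, 'b) form_operator set) \<Rightarrow> bool" where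
  "V0_submodule L s N \<longleftrightarrow> (\<forall>Q. openin (lb_top L) Q \<longrightarrow>
     tensor_relations L s Q \<subseteq> N Q \<and> N Q \<subseteq> form_operators L s Q \<and>
     (\<forall>\<Psi>\<in>N Q. \<forall>\<Phi>\<in>N Q. \<Psi> + \<Phi> \<in> N Q) \<and>
     (\<forall>\<Psi>\<in>N Q. \<forall>P\<in>V0_operators L Q. \<Psi> \<circ> P \<in> N Q) \<and>
     (\<forall>Q'. openin (lb_top L) Q' \<and> Q' \<subseteq> Q \<longrightarrow> N Q \<subseteq> N Q') \<and>
     (\<forall>\<Psi>\<in>form_operators L s Q.
        (\<forall>q\<in>Q. \<exists>Q'. openin (lb_top L) Q' \<and> q \<in> Q' \<and> Q' \<subseteq> Q \<and> \<Psi> \<in> N Q') \<longrightarrow> \<Psi> \<in> N Q))"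

definition V_less :: "('a, 'b) line_bundle \<Rightarrow> ('a \<Rightarrow> 'b) \<Rightarrow>
    (rat \<Rightarrow> 'b set \<Rightarrow> ('a, 'b) form_operator set) \<Rightarrow> rat \<Rightarrow> 'b set \<Rightarrow> ('a, 'b) form_operator set" where
  "V_less L s V \<alpha> Q = {\<Psi> \<in> form_operators L s Q.
     \<forall>q\<in>Q. \<exists>Q' \<beta>. openin (lb_top L) Q' \<and> q \<in> Q' \<and> Q' \<subseteq> Q \<and> \<beta> < \<alpha> \<and> \<Psi> \<in> V \<beta> Q'}"

text \<open>The Kashiwara-Malgrange filtration is the unique filtration with these properties. The set \<open>J\<close>
  of jumps is discrete in the rationals; as L need not be compact, this is a local condition on L.\<close>

definition kashiwara_malgrange_filtration :: "('a, 'b) line_bundle \<Rightarrow> ('a \<Rightarrow> 'b) \<Rightarrow>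
    (rat \<Rightarrow> 'b set \<Rightarrow> ('a, 'b) form_operator set) \<Rightarrow> bool" where
  "kashiwara_malgrange_filtration L s V \<longleftrightarrow>
     (\<forall>\<alpha>. V0_submodule L s (V \<alpha>) \<and>
          coherent_module (lb_top L) (V0_operators L) (\<circ>) (operator_eq L) (\<circ>) (image_eq L s) (V \<alpha>)) \<and>
     (\<forall>\<alpha> \<beta> Q. openin (lb_top L) Q \<and> \<alpha> \<le> \<beta> \<longrightarrow> V \<alpha> Q \<subseteq> V \<beta> Q) \<and>
     (\<forall>Q. \<forall>\<Psi>\<in>form_operators L s Q. \<forall>q\<in>Q.
        \<exists>Q' \<alpha>. openin (lb_top L) Q' \<and> q \<in> Q' \<and> Q' \<subseteq> Q \<and> \<Psi> \<in> V \<alpha> Q') \<and>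
     (\<forall>p\<in>topspace (lb_top L). \<exists>Q J. openin (lb_top L) Q \<and> p \<in> Q \<and>
        (\<forall>a b. finite (J \<inter> {a..b})) \<and>
        (\<forall>\<alpha> \<beta> Q'. \<alpha> \<le> \<beta> \<and> J \<inter> {\<alpha><..\<beta>} = {} \<and> openin (lb_top L) Q' \<and> Q' \<subseteq> Q
           \<longrightarrow> V \<alpha> Q' = V \<beta> Q')) \<and>
     (\<forall>\<alpha> Q. openin (lb_top L) Q \<longrightarrow> V \<alpha> Q = (\<Inter>\<beta>\<in>{\<alpha><..}. V \<beta> Q)) \<and>
     (\<forall>(U, \<tau>)\<in>lb_trivs L. \<forall>\<alpha> Q. openin (lb_top L) Q \<and> Q \<subseteq> over L U \<longrightarrow>
        (\<forall>\<Psi>\<in>V \<alpha> Q. \<Psi> \<circ> (\<lambda>h. \<tau> * h) \<in> V (\<alpha> - 1) Q) \<and>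
        (\<alpha> < 0 \<longrightarrow> (\<forall>\<Phi>\<in>V (\<alpha> - 1) Q. \<forall>q\<in>Q. \<exists>Q'. \<exists>\<Psi>\<in>V \<alpha> Q'.
           openin (lb_top L) Q' \<and> q \<in> Q' \<and> Q' \<subseteq> Q \<and> image_eq L s Q' \<Phi> (\<Psi> \<circ> (\<lambda>h. \<tau> * h)))) \<and>
        (\<forall>\<Psi>\<in>V \<alpha> Q. \<Psi> \<circ> fibre_deriv L U \<tau> \<in> V (\<alpha> + 1) Q)) \<and>
     (\<forall>(U, \<tau>)\<in>lb_trivs L. \<forall>\<alpha>. \<forall>p\<in>over L U. \<exists>Q N. openin (lb_top L) Q \<and> p \<in> Q \<and> Q \<subseteq> over L U \<and>
        (\<forall>Q'. openin (lb_top L) Q' \<and> Q' \<subseteq> Q \<longrightarrow> (\<forall>\<Psi>\<in>V \<alpha> Q'.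
           \<Psi> \<circ> ((\<lambda>h q. \<tau> q * fibre_deriv L U \<tau> h q - of_rat \<alpha> * h q) ^^ N) \<in> V_less L s V \<alpha> Q')))"

section \<open>Higher multiplier ideals\<close>

text \<open>The isomorphism of \<open>\<omega>\<^sub>X \<otimes> L\<^sup>k\<close> with the graded piece of index \<open>-n + k\<close>. With \<open>e\<close> the frame of \<open>L\<close>
  dual to the fibre coordinate \<open>\<tau>\<close>, it sends \<open>g dx \<otimes> e\<^sup>k\<close>, \<open>dx\<close> being the form \<open>dx\<^sub>1 \<and> ... \<and> dx\<^sub>n\<close> of the
  chart \<open>c\<close>, to the class of \<open>g dx \<otimes> \<partial>\<^sub>t\<^sup>k\<close>.\<close>

definition graded_section :: "('a, 'b) line_bundle \<Rightarrow> ('a \<Rightarrow> 'b) \<Rightarrow> 'a chart \<Rightarrow>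
    'a set \<times> ('b \<Rightarrow> complex) \<Rightarrow> nat \<Rightarrow> ('a \<Rightarrow> complex) \<Rightarrow> ('a, 'b) form_operator" where
  "graded_section L s c T k g =
     (\<lambda>h c' x. jacobian (lb_base L) c' c x * g x * (fibre_deriv L (fst T) (snd T) ^^ k) h (s x))"

text \<open>\<open>J\<close> is the coherent ideal sheaf such that \<open>(F\<^bsub>-n+k\<^esub>M \<inter> V\<^sub>\<alpha>M) / (F\<^bsub>-n+k-1\<^esub>M \<inter> V\<^sub>\<alpha>M)\<close>, as a subsheaf
  of the graded piece of index \<open>-n + k\<close>, is the image of \<open>\<omega>\<^sub>X \<otimes> L\<^sup>k \<otimes> J\<close>. The equality is tested on all
  open sets over which \<open>\<omega>\<^sub>X\<close> and \<open>L\<close> are trivial.\<close>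

definition is_higher_multiplier_ideal :: "('a, 'b) line_bundle \<Rightarrow> ('a \<Rightarrow> 'b) \<Rightarrow>
    (rat \<Rightarrow> 'b set \<Rightarrow> ('a, 'b) form_operator set) \<Rightarrow> nat \<Rightarrow> rat \<Rightarrow>
    ('a set \<Rightarrow> ('a \<Rightarrow> complex) set) \<Rightarrow> bool" where
  "is_higher_multiplier_ideal L s V k \<alpha> J \<longleftrightarrow>
     coherent_ideal_sheaf (lb_base L) J \<and>
     (\<forall>c\<in>matlas (lb_base L). \<forall>T\<in>lb_trivs L. \<forall>W.
        openin (mtop (lb_base L)) W \<and> W \<subseteq> fst c \<inter> fst T \<longrightarrow>
        J W = {g \<in> structure_sheaf (lb_base L) W. \<forall>x\<in>W. \<exists>W'.
                 openin (mtop (lb_base L)) W' \<and> x \<in> W' \<and> W' \<subseteq> W \<and>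
                 (\<exists>\<Psi> \<in> hodge_filtration L s (int k - int (mdim (lb_base L))) (over L W') \<inter> V \<alpha> (over L W').
                    \<Psi> - graded_section L s c T k g
                      \<in> hodge_filtration L s (int k - int (mdim (lb_base L)) - 1) (over L W'))})"

end

theory Submission
  imports Defs "HOL-Complex_Analysis.Cauchy_Integral_Formula"
begin

text \<open>Over a trivialisation of \<open>L\<close> with fibre coordinate \<open>t\<close>, let \<open>f = t \<circ> s\<close>. The operator \<open>t - f\<close> lies
  in \<open>V\<^sub>0D\<close>, so it preserves \<open>V\<^sub>\<alpha>M\<close>. As it vanishes along \<open>s\<close>, right multiplication by it is a commutator
  and lowers the order by one: \<open>F\<^bsub>-n+k+1\<^esub>M (t - f) \<subseteq> F\<^bsub>-n+k\<^esub>M\<close>. On graded pieces it sends the class of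
  \<open>g dx \<otimes> \<partial>\<^sub>t\<^bsup>k+1\<^esup>\<close> to \<open>k + 1\<close> times the class of \<open>g dx \<otimes> \<partial>\<^sub>t\<^sup>k\<close>, since \<open>\<partial>\<^sub>t\<^bsup>k+1\<^esup> (t - f) = (t - f) \<partial>\<^sub>t\<^bsup>k+1\<^esup> + (k + 1) \<partial>\<^sub>t\<^sup>k\<close>.\<close>

section \<open>Holomorphic functions\<close>

text \<open>Multiplication by \<open>t\<close> alone respects \<open>V\<^sub>\<alpha>M\<close> but
  need not lower the Hodge index, since \<open>t\<close> takes the value \<open>f\<close> along the
  section; subtracting \<open>f\<close> makes the function vanish on the image of \<open>s\<close>.
  The drop by one is needed twice: for a section of M representing a graded class, and for its
  difference from the leading term, which lies one step lower. Only then does multiplication descend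
  to graded pieces. The multiplier carries the constant 1/(k + 1), so that one and the same function
  \<open>g\<close> witnesses membership in both ideals.

  The multiplier depends on the trivialisation, so the inclusion is proved where a chart and a
  trivialisation are both defined, and then glued by the sheaf property of the ideals.

  The main obstacle is one of encoding: functions and operators are total, and only their values at
  points of the given open set, on arguments holomorphic near the image point, carry meaning. Hence
  every notion, from holomorphy up to the Hodge filtration, receives a congruence lemma before
  identities can be transported through it.\<close>

lemma complex_space_eq: "complex_space n = top_of_set {z. \<forall>i\<ge>n. z i = 0}"
  by (simp add: complex_space_def euclidean_product_topology)

lemma topspace_complex_space: "topspace (complex_space n) = {z. \<forall>i\<ge>n. z i = 0}"
  by (simp add: complex_space_eq)

text \<open>An open set lies inside the coordinate subspace, so the nested subtopology collapses to
  \<open>top_of_set\<close> and continuity becomes \<open>continuous_on\<close>.\<close>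

lemma holomorphic_fun_iff:
  "holomorphic_fun n \<Omega> f \<longleftrightarrow> openin (complex_space n) \<Omega> \<and> continuous_on \<Omega> f \<and>
     (\<forall>z\<in>\<Omega>. \<forall>i<n. (\<lambda>w. f (z(i := w))) field_differentiable at (z i))"
proof (cases "openin (complex_space n) \<Omega>")
  case True
  then have "\<Omega> \<subseteq> {z. \<forall>i\<ge>n. z i = 0}"
    using openin_subset topspace_complex_space by blast
  then have "subtopology (complex_space n) \<Omega> = top_of_set \<Omega>"
    by (simp add: complex_space_eq subtopology_subtopology Int_absorb1)
  then show ?thesis
    by (simp add: holomorphic_fun_def continuous_map_iff_continuous)
qed (simp add: holomorphic_fun_def)

lemma continuous_on_fun_upd_coordinate:
  "continuous_on UNIV (\<lambda>w::complex. (z::nat \<Rightarrow> complex)(i := w))"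
proof (rule continuous_on_coordinatewise_then_product)
  show "continuous_on UNIV (\<lambda>w. (z(i := w)) j)" for j
    by (cases "j = i") auto
qed

text \<open>Changing a coordinate with index below \<open>n\<close> stays inside the coordinate
  subspace, so openness there gives a full neighbourhood in that one complex variable. This makes
  partial derivatives depend only on values inside the open set.\<close>

lemma openin_complex_space_coordinate:
  assumes "openin (complex_space n) \<Omega>" "z \<in> \<Omega>" "i < n"
  shows "\<forall>\<^sub>F w in nhds (z i). z(i := w) \<in> \<Omega>"
proof -
  obtain T where T: "open T" "\<Omega> = {z. \<forall>i\<ge>n. z i = 0} \<inter> T"
    using assms(1) unfolding complex_space_eq openin_open by blast
  have "open ((\<lambda>w. z(i := w)) -` T)"
    using continuous_on_fun_upd_coordinate T(1) by (rule open_vimage[rotated])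
  moreover have "z i \<in> (\<lambda>w. z(i := w)) -` T"
    using assms(2) T by simp
  ultimately have "\<forall>\<^sub>F w in nhds (z i). w \<in> (\<lambda>w. z(i := w)) -` T"
    by (rule eventually_nhds_in_open)
  then show ?thesis
    using assms(2,3) T by (auto elim!: eventually_mono)
qed

text \<open>Each partial derivative sees only nearby values on a coordinate line, and these are
  taken inside \<Omega>.\<close>

lemma holomorphic_fun_cong:
  assumes "holomorphic_fun n \<Omega> f" "\<And>z. z \<in> \<Omega> \<Longrightarrow> f z = g z"
  shows "holomorphic_fun n \<Omega> g"
proof -
  have "(\<lambda>w. g (z(i := w))) field_differentiable at (z i)" if z: "z \<in> \<Omega>" "i < n" for z i
  proof -
    have ev: "\<forall>\<^sub>F w in nhds (z i). f (z(i := w)) = g (z(i := w))"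
      using openin_complex_space_coordinate[of n \<Omega> z i] assms z
      by (auto simp: holomorphic_fun_iff elim!: eventually_mono)
    obtain d where "((\<lambda>w. f (z(i := w))) has_field_derivative d) (at (z i))"
      using assms(1) z by (auto simp: holomorphic_fun_iff field_differentiable_def)
    then have "((\<lambda>w. g (z(i := w))) has_field_derivative d) (at (z i))"
      using DERIV_cong_ev[OF refl ev refl] by simp
    then show ?thesis
      by (auto simp: field_differentiable_def)
  qed
  moreover have "continuous_on \<Omega> g"
    using assms continuous_on_cong[of \<Omega> \<Omega> f g] by (simp add: holomorphic_fun_iff)
  ultimately show ?thesis
    using assms(1) by (auto simp: holomorphic_fun_iff)
qed

lemma holomorphic_fun_subset:
  assumes "holomorphic_fun n \<Omega> f" "openin (complex_space n) \<Omega>'" "\<Omega>' \<subseteq> \<Omega>"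
  shows "holomorphic_fun n \<Omega>' f"
  using assms continuous_on_subset by (auto simp: holomorphic_fun_iff)

lemma holomorphic_fun_const: "openin (complex_space n) \<Omega> \<Longrightarrow> holomorphic_fun n \<Omega> (\<lambda>z. a)"
  by (simp add: holomorphic_fun_iff)

lemma holomorphic_fun_add:
  "holomorphic_fun n \<Omega> f \<Longrightarrow> holomorphic_fun n \<Omega> g \<Longrightarrow> holomorphic_fun n \<Omega> (\<lambda>z. f z + g z)"
  by (auto simp: holomorphic_fun_iff intro!: continuous_intros field_differentiable_add)

lemma holomorphic_fun_mult:
  "holomorphic_fun n \<Omega> f \<Longrightarrow> holomorphic_fun n \<Omega> g \<Longrightarrow> holomorphic_fun n \<Omega> (\<lambda>z. f z * g z)"
  by (auto simp: holomorphic_fun_iff intro!: continuous_intros field_differentiable_mult)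

lemma holomorphic_fun_coordinate:
  assumes "openin (complex_space n) \<Omega>"
  shows "holomorphic_fun n \<Omega> (\<lambda>z. z i)"
proof -
  have "continuous_on \<Omega> (\<lambda>z. z i)"
    by (rule continuous_on_product_then_coordinatewise) (rule continuous_on_id)
  moreover have "(\<lambda>w. (z(j := w)) i) field_differentiable at (z j)" for z :: "nat \<Rightarrow> complex" and j
    by (cases "i = j") auto
  ultimately show ?thesis
    using assms by (simp add: holomorphic_fun_iff)
qed

section \<open>Functions of n variables regarded as functions of n + 1 variables\<close>

text \<open>The coordinate image of a line bundle over a set with coordinate image \<Omega>: the
  entry at \<open>n\<close> is the free fibre coordinate. Resetting it to 0 is the projection,
  because points of the n-dimensional space vanish from index \<open>n\<close> on.\<close>

definition cylinder :: "nat \<Rightarrow> (nat \<Rightarrow> complex) set \<Rightarrow> (nat \<Rightarrow> complex) set" where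
  "cylinder n \<Omega> = {z \<in> topspace (complex_space (Suc n)). z(n := 0) \<in> \<Omega>}"

lemma continuous_on_drop_coordinate:
  "continuous_on A (\<lambda>z::nat \<Rightarrow> complex. z(n := 0))"
proof (rule continuous_on_coordinatewise_then_product)
  show "continuous_on A (\<lambda>z. (z(n := 0)) i)" for i
    by (cases "i = n") (auto intro: continuous_on_product_then_coordinatewise continuous_on_id)
qed

lemma openin_cylinder:
  assumes "openin (complex_space n) \<Omega>"
  shows "openin (complex_space (Suc n)) (cylinder n \<Omega>)"
proof -
  have "continuous_map (complex_space (Suc n)) (complex_space n) (\<lambda>z. z(n := 0))"
    unfolding complex_space_eq
    by (auto simp: continuous_on_drop_coordinate)
  then show ?thesis
    using openin_continuous_map_preimage[OF _ assms] by (simp add: cylinder_def)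
qed

text \<open>The function is constant in direction \<open>n\<close>; in every other direction the
  update commutes with resetting entry \<open>n\<close>.\<close>

lemma holomorphic_fun_cylinder:
  assumes "holomorphic_fun n \<Omega> f"
  shows "holomorphic_fun (Suc n) (cylinder n \<Omega>) (\<lambda>z. f (z(n := 0)))"
proof -
  have "continuous_on (cylinder n \<Omega>) (\<lambda>z. f (z(n := 0)))"
    using assms
    by (auto simp: holomorphic_fun_iff cylinder_def
        intro!: continuous_on_compose2[OF _ continuous_on_drop_coordinate])
  moreover have "(\<lambda>w. f ((z(i := w))(n := 0))) field_differentiable at (z i)"
    if z: "z \<in> cylinder n \<Omega>" "i < Suc n" for z i
  proof (cases "i = n")
    case False
    then have "(\<lambda>w. f ((z(n := 0))(i := w))) field_differentiable at ((z(n := 0)) i)"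
      using assms z bspec[of \<Omega> _ "z(n := 0)"] by (auto simp: holomorphic_fun_iff cylinder_def)
    then show ?thesis
      using False by (simp add: fun_upd_twist[of i n])
  qed simp
  ultimately show ?thesis
    using assms openin_cylinder by (auto simp: holomorphic_fun_iff)
qed

section \<open>Structure sheaves and differential operators\<close>

text \<open>Isolated because it serves both X and the total space of the bundle: injectivity lets
  \<open>inv_into\<close> recover the point itself, so that values away from the open set never
  enter.\<close>

definition inj_charts :: "'a cmanifold \<Rightarrow> bool" where
  "inj_charts X \<longleftrightarrow> (\<forall>(U, \<phi>)\<in>matlas X. inj_on \<phi> U)"

lemma inj_chartsD: "inj_charts X \<Longrightarrow> (U, \<phi>) \<in> matlas X \<Longrightarrow> inj_on \<phi> U"
  by (auto simp: inj_charts_def)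

lemma structure_sheaf_cong:
  assumes "inj_charts X" "f \<in> structure_sheaf X W" "\<And>x. x \<in> W \<Longrightarrow> f x = g x"
  shows "g \<in> structure_sheaf X W"
proof -
  have "holomorphic_fun (mdim X) (\<phi> ` (U \<inter> W)) (g \<circ> inv_into U \<phi>)" if c: "(U, \<phi>) \<in> matlas X" for U \<phi>
  proof (rule holomorphic_fun_cong)
    show "holomorphic_fun (mdim X) (\<phi> ` (U \<inter> W)) (f \<circ> inv_into U \<phi>)"
      using assms(2) c by (auto simp: structure_sheaf_def)
  qed (use assms(3) inj_chartsD[OF assms(1) c] in auto)
  then show ?thesis
    using assms(2) by (auto simp: structure_sheaf_def)
qed

text \<open>Two different domains are allowed because a fixed multiplier is later paired with test
  functions on arbitrary open sets. Injectivity of the charts turns the image of the intersection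
  into the intersection of the images.\<close>

lemma structure_sheaf_mult:
  assumes "inj_charts X" "f \<in> structure_sheaf X A" "g \<in> structure_sheaf X B"
  shows "f * g \<in> structure_sheaf X (A \<inter> B)"
proof -
  have "holomorphic_fun (mdim X) (\<phi> ` (U \<inter> (A \<inter> B))) ((f * g) \<circ> inv_into U \<phi>)"
    if c: "(U, \<phi>) \<in> matlas X" for U \<phi>
  proof -
    have f: "holomorphic_fun (mdim X) (\<phi> ` (U \<inter> A)) (f \<circ> inv_into U \<phi>)"
      and g: "holomorphic_fun (mdim X) (\<phi> ` (U \<inter> B)) (g \<circ> inv_into U \<phi>)"
      using assms c by (auto simp: structure_sheaf_def)
    have eq: "\<phi> ` (U \<inter> (A \<inter> B)) = \<phi> ` (U \<inter> A) \<inter> \<phi> ` (U \<inter> B)"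
      using inj_chartsD[OF assms(1) c] by (auto simp: inj_on_def)
    have op: "openin (complex_space (mdim X)) (\<phi> ` (U \<inter> (A \<inter> B)))"
      using f g unfolding eq holomorphic_fun_iff by auto
    show ?thesis
      using holomorphic_fun_mult[OF holomorphic_fun_subset[OF f op] holomorphic_fun_subset[OF g op]]
      unfolding eq by (auto simp: comp_def)
  qed
  then show ?thesis
    using assms by (auto simp: structure_sheaf_def)
qed

lemma structure_sheaf_lincomb:
  assumes "f \<in> structure_sheaf X A" "g \<in> structure_sheaf X A"
  shows "(\<lambda>x. a * f x + b * g x) \<in> structure_sheaf X A"
proof -
  have "holomorphic_fun (mdim X) (\<phi> ` (U \<inter> A)) ((\<lambda>x. a * f x + b * g x) \<circ> inv_into U \<phi>)"
    if c: "(U, \<phi>) \<in> matlas X" for U \<phi>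
  proof -
    have f: "holomorphic_fun (mdim X) (\<phi> ` (U \<inter> A)) (f \<circ> inv_into U \<phi>)"
      and g: "holomorphic_fun (mdim X) (\<phi> ` (U \<inter> A)) (g \<circ> inv_into U \<phi>)"
      using assms c by (auto simp: structure_sheaf_def)
    then have op: "openin (complex_space (mdim X)) (\<phi> ` (U \<inter> A))"
      by (simp add: holomorphic_fun_iff)
    show ?thesis
      using holomorphic_fun_add[OF holomorphic_fun_mult[OF holomorphic_fun_const[OF op] f]
          holomorphic_fun_mult[OF holomorphic_fun_const[OF op] g], of a b]
      by (simp add: comp_def)
  qed
  then show ?thesis
    using assms by (auto simp: structure_sheaf_def)
qed

section \<open>Order and locality of differential operators\<close>

lemma order_less_0D:
  "order_less Y s 0 W P \<Longrightarrow> h \<in> structure_sheaf Y Q \<Longrightarrow> x \<in> W \<Longrightarrow> s x \<in> Q \<Longrightarrow> P h x = 0"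
  unfolding order_less.simps by (drule spec, drule (1) bspec, erule bspec) simp

lemma order_less_0I:
  assumes "\<And>Q h x. h \<in> structure_sheaf Y Q \<Longrightarrow> x \<in> W \<Longrightarrow> s x \<in> Q \<Longrightarrow> P h x = 0"
  shows "order_less Y s 0 W P"
  unfolding order_less.simps by (intro allI ballI, elim IntE vimageE) (rule assms, simp_all)

lemma order_less_SucD:
  "order_less Y s (Suc k) W P \<Longrightarrow> a \<in> structure_sheaf Y Q \<Longrightarrow>
     order_less Y s k (W \<inter> s -` Q) (\<lambda>h x. P (a * h) x - a (s x) * P h x)"
  unfolding order_less.simps by (drule spec, erule (1) bspec)

lemma order_less_SucI:
  assumes "\<And>Q a. a \<in> structure_sheaf Y Q \<Longrightarrow>
    order_less Y s k (W \<inter> s -` Q) (\<lambda>h x. P (a * h) x - a (s x) * P h x)"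
  shows "order_less Y s (Suc k) W P"
  unfolding order_less.simps by (intro allI ballI assms)

text \<open>The commutator with \<open>a\<close> evaluates the operator at \<open>a * h\<close> as
  well as at \<open>h\<close>. Agreement is therefore assumed for test functions on all open sets,
  including the smaller domain of the product.\<close>

lemma order_less_cong:
  assumes "inj_charts Y" "order_less Y s k W P"
    "\<And>Q h x. h \<in> structure_sheaf Y Q \<Longrightarrow> x \<in> W \<Longrightarrow> s x \<in> Q \<Longrightarrow> P h x = P' h x"
  shows "order_less Y s k W P'"
  using assms(2,3)
proof (induction k arbitrary: W P P')
  case 0
  show ?case
  proof (rule order_less_0I)
    fix Q h x assume h: "h \<in> structure_sheaf Y Q" "x \<in> W" "s x \<in> Q"
    show "P' h x = 0"
      using order_less_0D[OF 0(1) h] 0(2)[OF h] by (simp only:)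
  qed
next
  case (Suc k)
  show ?case
  proof (rule order_less_SucI)
    fix Q a assume a: "a \<in> structure_sheaf Y Q"
    show "order_less Y s k (W \<inter> s -` Q) (\<lambda>h x. P' (a * h) x - a (s x) * P' h x)"
    proof (rule Suc.IH[OF order_less_SucD[OF Suc.prems(1) a]])
      fix Q' h x assume h: "h \<in> structure_sheaf Y Q'" "x \<in> W \<inter> s -` Q" "s x \<in> Q'"
      then have x: "x \<in> W" "s x \<in> Q \<inter> Q'"
        by auto
      show "P (a * h) x - a (s x) * P h x = P' (a * h) x - a (s x) * P' h x"
        using Suc.prems(2)[OF structure_sheaf_mult[OF assms(1) a h(1)] x]
          Suc.prems(2)[OF h(1) x(1) h(3)] by (simp only:)
    qed
  qed
qed

lemma order_less_subset:
  "order_less Y s k W P \<Longrightarrow> W' \<subseteq> W \<Longrightarrow> order_less Y s k W' P"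
proof (induction k arbitrary: W W' P)
  case 0
  show ?case
    by (rule order_less_0I, rule order_less_0D[OF 0(1)], assumption) (use 0(2) in blast)+
next
  case (Suc k)
  show ?case
    by (rule order_less_SucI, rule Suc.IH, erule order_less_SucD[OF Suc.prems(1)])
      (use Suc.prems(2) in blast)
qed

text \<open>Functions commute, so the commutator of \<open>P \<circ> m\<close> with \<open>a\<close>
  is the commutator of \<open>P\<close> with \<open>a\<close>, composed with \<open>m\<close>; the
  induction passes through this identity.\<close>

lemma order_less_comp_mult:
  assumes "inj_charts Y" "m \<in> structure_sheaf Y Q0" "order_less Y s k W P" "W \<subseteq> s -` Q0"
  shows "order_less Y s k W (P \<circ> (\<lambda>h. m * h))"
  using assms(3,4)
proof (induction k arbitrary: W P)
  case 0
  show ?case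
  proof (rule order_less_0I)
    fix Q h x assume h: "h \<in> structure_sheaf Y Q" "x \<in> W" "s x \<in> Q"
    then have "s x \<in> Q0 \<inter> Q"
      using 0(2) by auto
    from order_less_0D[OF 0(1) structure_sheaf_mult[OF assms(1,2) h(1)] h(2) this]
    show "(P \<circ> (\<lambda>h. m * h)) h x = 0"
      unfolding comp_def .
  qed
next
  case (Suc k)
  show ?case
  proof (rule order_less_SucI)
    fix Q a assume a: "a \<in> structure_sheaf Y Q"
    have "W \<inter> s -` Q \<subseteq> s -` Q0"
      using Suc.prems(2) by blast
    from Suc.IH[OF order_less_SucD[OF Suc.prems(1) a] this]
    show "order_less Y s k (W \<inter> s -` Q)
        (\<lambda>h x. (P \<circ> (\<lambda>h. m * h)) (a * h) x - a (s x) * (P \<circ> (\<lambda>h. m * h)) h x)"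
      by (simp only: comp_def mult.left_commute[of a m])
  qed
qed

text \<open>The commutator in the definition of order evaluates \<open>m\<close> at
  \<open>s x\<close>, where it is 0; what remains is \<open>P (m * h)\<close>.\<close>

lemma order_less_comp_mult_vanishing:
  assumes "inj_charts Y" "m \<in> structure_sheaf Y Q0" "order_less Y s (Suc k) W P"
    "\<And>x. x \<in> W \<Longrightarrow> s x \<in> Q0 \<and> m (s x) = 0"
  shows "order_less Y s k W (P \<circ> (\<lambda>h. m * h))"
proof -
  have "order_less Y s k W (\<lambda>h x. P (m * h) x - m (s x) * P h x)"
    by (rule order_less_subset[OF order_less_SucD[OF assms(3,2)]]) (use assms(4) in auto)
  then show ?thesis
    by (rule order_less_cong[OF assms(1)]) (simp only: assms(4) comp_def mult_zero_left diff_zero)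
qed

lemma local_operatorD:
  assumes "local_operator Y X s W P" "h \<in> structure_sheaf Y Q"
  shows "P h \<in> structure_sheaf X (W \<inter> s -` Q)"
    and "h' \<in> structure_sheaf Y Q \<Longrightarrow> fun_eq_on Q h h' \<Longrightarrow> fun_eq_on (W \<inter> s -` Q) (P h) (P h')"
    and "h' \<in> structure_sheaf Y Q \<Longrightarrow> x \<in> W \<Longrightarrow> s x \<in> Q \<Longrightarrow>
           P (\<lambda>p. a * h p + b * h' p) x = a * P h x + b * P h' x"
proof -
  note P = assms(1)[unfolded local_operator_def]
  show "P h \<in> structure_sheaf X (W \<inter> s -` Q)"
    by (rule P[THEN conjunct1, rule_format, OF assms(2)])
  show "fun_eq_on (W \<inter> s -` Q) (P h) (P h')"
    if "h' \<in> structure_sheaf Y Q" "fun_eq_on Q h h'"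
    by (rule P[THEN conjunct2, THEN conjunct1, rule_format, OF assms(2) that])
  show "P (\<lambda>p. a * h p + b * h' p) x = a * P h x + b * P h' x"
    if "h' \<in> structure_sheaf Y Q" "x \<in> W" "s x \<in> Q"
    by (rule P[THEN conjunct2, THEN conjunct2, rule_format, OF assms(2) that(1)]) (use that in simp)
qed

lemma local_operator_cong:
  assumes "inj_charts X" "local_operator Y X s W P"
    "\<And>Q h x. h \<in> structure_sheaf Y Q \<Longrightarrow> x \<in> W \<Longrightarrow> s x \<in> Q \<Longrightarrow> P h x = P' h x"
  shows "local_operator Y X s W P'"
  unfolding local_operator_def
proof (intro conjI allI ballI impI)
  fix Q h assume h: "h \<in> structure_sheaf Y Q"
  show "P' h \<in> structure_sheaf X (W \<inter> s -` Q)"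
    using local_operatorD(1)[OF assms(2) h]
    by (rule structure_sheaf_cong[OF assms(1)]) (use assms(3)[OF h] in auto)
next
  fix Q h h' assume h: "h \<in> structure_sheaf Y Q" "h' \<in> structure_sheaf Y Q" "fun_eq_on Q h h'"
  show "fun_eq_on (W \<inter> s -` Q) (P' h) (P' h')"
    using local_operatorD(2)[OF assms(2) h] assms(3)[OF h(1)] assms(3)[OF h(2)]
    by (simp add: fun_eq_on_def)
next
  fix Q a b h h' x
  assume h: "h \<in> structure_sheaf Y Q" "h' \<in> structure_sheaf Y Q" "x \<in> W \<inter> s -` Q"
  then have x: "x \<in> W" "s x \<in> Q"
    by auto
  show "P' (\<lambda>p. a * h p + b * h' p) x = a * P' h x + b * P' h' x"
    using local_operatorD(3)[OF assms(2) h(1,2) x, of a b]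
    unfolding assms(3)[OF h(1) x] assms(3)[OF h(2) x] assms(3)[OF structure_sheaf_lincomb[OF h(1,2)] x] .
qed

lemma diff_operatorsI:
  assumes "openin (mtop X) W" "local_operator Y X s W P"
    "\<And>x. x \<in> W \<Longrightarrow> \<exists>W' k. openin (mtop X) W' \<and> x \<in> W' \<and> W' \<subseteq> W \<and> order_less Y s k W' P"
  shows "P \<in> diff_operators Y X s W"
  using assms by (simp add: diff_operators_def)

lemma diff_operatorsD:
  assumes "P \<in> diff_operators Y X s W"
  shows "openin (mtop X) W" "local_operator Y X s W P"
    and "x \<in> W \<Longrightarrow> \<exists>W' k. openin (mtop X) W' \<and> x \<in> W' \<and> W' \<subseteq> W \<and> order_less Y s k W' P"
  using assms by (simp_all add: diff_operators_def)

lemma diff_operators_cong: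
  assumes "inj_charts X" "inj_charts Y" "P \<in> diff_operators Y X s W"
    "\<And>Q h x. h \<in> structure_sheaf Y Q \<Longrightarrow> x \<in> W \<Longrightarrow> s x \<in> Q \<Longrightarrow> P h x = P' h x"
  shows "P' \<in> diff_operators Y X s W"
proof (rule diff_operatorsI)
  fix x assume "x \<in> W"
  then obtain W' k where W': "openin (mtop X) W'" "x \<in> W'" "W' \<subseteq> W" "order_less Y s k W' P"
    using diff_operatorsD(3)[OF assms(3)] by blast
  have "order_less Y s k W' P'"
    by (rule order_less_cong[OF assms(2) W'(4)], rule assms(4), assumption) (use W'(3) in blast)+
  with W'(1-3) show "\<exists>W' k. openin (mtop X) W' \<and> x \<in> W' \<and> W' \<subseteq> W \<and> order_less Y s k W' P'"
    by blast
next
  show "local_operator Y X s W P'"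
    by (rule local_operator_cong[OF assms(1) diff_operatorsD(2)[OF assms(3)] assms(4)])
qed (rule diff_operatorsD(1)[OF assms(3)])

lemma local_operator_comp_mult:
  assumes "inj_charts Y" "m \<in> structure_sheaf Y Q0" "local_operator Y X s W P" "W \<subseteq> s -` Q0"
  shows "local_operator Y X s W (P \<circ> (\<lambda>h. m * h))"
proof -
  \<comment> \<open>The product \<open>m * h\<close> lives only on \<open>Q0 \<inter> Q\<close>, but
    \<open>s\<close> maps \<open>W\<close> into \<open>Q0\<close>, so no points of \<open>W\<close>
    are lost.\<close>
  have W: "W \<inter> s -` (Q0 \<inter> Q) = W \<inter> s -` Q" for Q
    using assms(4) by auto
  note mult = structure_sheaf_mult[OF assms(1,2)]
  show ?thesis
    unfolding local_operator_def comp_def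
  proof (intro conjI allI ballI impI)
    fix Q h assume "h \<in> structure_sheaf Y Q"
    from local_operatorD(1)[OF assms(3) mult[OF this]]
    show "P (m * h) \<in> structure_sheaf X (W \<inter> s -` Q)"
      unfolding W .
  next
    fix Q h h' assume h: "h \<in> structure_sheaf Y Q" "h' \<in> structure_sheaf Y Q" "fun_eq_on Q h h'"
    have "fun_eq_on (Q0 \<inter> Q) (m * h) (m * h')"
      using h(3) by (auto simp: fun_eq_on_def)
    from local_operatorD(2)[OF assms(3) mult[OF h(1)] mult[OF h(2)] this]
    show "fun_eq_on (W \<inter> s -` Q) (P (m * h)) (P (m * h'))"
      unfolding W .
  next
    fix Q a b h h' x
    assume h: "h \<in> structure_sheaf Y Q" "h' \<in> structure_sheaf Y Q" "x \<in> W \<inter> s -` Q"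
    then have x: "x \<in> W" "s x \<in> Q0 \<inter> Q"
      using assms(4) by auto
    have "m * (\<lambda>p. a * h p + b * h' p) = (\<lambda>p. a * (m * h) p + b * (m * h') p)"
      by (auto simp: algebra_simps)
    then show "P (m * (\<lambda>p. a * h p + b * h' p)) x = a * P (m * h) x + b * P (m * h') x"
      using local_operatorD(3)[OF assms(3) mult[OF h(1)] mult[OF h(2)] x, of a b] by (simp only:)
  qed
qed

lemma diff_operators_comp_mult:
  assumes "inj_charts Y" "m \<in> structure_sheaf Y Q0" "P \<in> diff_operators Y X s W" "W \<subseteq> s -` Q0"
  shows "P \<circ> (\<lambda>h. m * h) \<in> diff_operators Y X s W"
proof (rule diff_operatorsI)
  fix x assume "x \<in> W"
  then obtain W' k where W': "openin (mtop X) W'" "x \<in> W'" "W' \<subseteq> W" "order_less Y s k W' P"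
    using diff_operatorsD(3)[OF assms(3)] by blast
  have "order_less Y s k W' (P \<circ> (\<lambda>h. m * h))"
    using W'(3) assms(4) by (intro order_less_comp_mult[OF assms(1,2) W'(4)]) blast
  with W'(1-3) show "\<exists>W' k. openin (mtop X) W' \<and> x \<in> W' \<and> W' \<subseteq> W \<and> order_less Y s k W' (P \<circ> (\<lambda>h. m * h))"
    by blast
next
  show "local_operator Y X s W (P \<circ> (\<lambda>h. m * h))"
    by (rule local_operator_comp_mult[OF assms(1,2) diff_operatorsD(2)[OF assms(3)] assms(4)])
qed (rule diff_operatorsD(1)[OF assms(3)])

text \<open>Multiplication by \<open>m\<close> is the identity operator composed with
  \<open>m\<close>. Membership of 1 encodes that \<open>W\<close> is open and that sections can be
  restricted to it.\<close>

lemma mult_diff_operator: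
  assumes "inj_charts Y" "m \<in> structure_sheaf Y Q0" "1 \<in> structure_sheaf Y W" "W \<subseteq> Q0"
  shows "(\<lambda>h. m * h) \<in> diff_operators Y Y id W"
proof -
  \<comment> \<open>Restriction is obtained as multiplication by the section 1 over
    \<open>W\<close>.\<close>
  have "h \<in> structure_sheaf Y (W \<inter> Q)" if "h \<in> structure_sheaf Y Q" for Q h
    using structure_sheaf_mult[OF assms(1,3) that] by simp
  then have "local_operator Y Y id W (\<lambda>h. h)"
    unfolding local_operator_def fun_eq_on_def by simp
  \<comment> \<open>The bound is strict: order 0 means order less than 1, and the commutator of the
    identity with a function is zero.\<close>
  moreover have "order_less Y id (Suc 0) W (\<lambda>h. h)"
    by (intro order_less_SucI order_less_0I) simp
  moreover have "openin (mtop Y) W"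
    using assms(3) by (simp add: structure_sheaf_def)
  ultimately have "(\<lambda>h. h) \<in> diff_operators Y Y id W"
    by (intro diff_operatorsI) blast+
  from diff_operators_comp_mult[OF assms(1,2) this] assms(4) show ?thesis
    by (simp add: comp_def)
qed


section \<open>The total space of a line bundle\<close>

lemma complex_manifold_chart:
  assumes "complex_manifold X" "(U, \<phi>) \<in> matlas X"
  shows "openin (mtop X) U" "openin (complex_space (mdim X)) (\<phi> ` U)"
    and "homeomorphic_map (subtopology (mtop X) U) (subtopology (complex_space (mdim X)) (\<phi> ` U)) \<phi>"
  using assms unfolding complex_manifold_def by blast+

lemma complex_manifold_inj_charts:
  assumes "complex_manifold X"
  shows "inj_charts X"
proof -
  have "inj_on \<phi> U" if "(U, \<phi>) \<in> matlas X" for U \<phi>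
    using homeomorphic_imp_injective_map[OF complex_manifold_chart(3)[OF assms that]]
      openin_subset[OF complex_manifold_chart(1)[OF assms that]]
    by (simp add: Int_absorb1)
  then show ?thesis
    by (auto simp: inj_charts_def)
qed

lemma complex_manifold_open_chart:
  assumes "complex_manifold X" "(U, \<phi>) \<in> matlas X" "openin (mtop X) W" "W \<subseteq> U"
  shows "openin (complex_space (mdim X)) (\<phi> ` W)"
proof -
  have "openin (subtopology (mtop X) U) W"
    using assms(3,4) by (auto simp: openin_subtopology)
  then have "openin (subtopology (complex_space (mdim X)) (\<phi> ` U)) (\<phi> ` W)"
    using homeomorphic_imp_open_map[OF complex_manifold_chart(3)[OF assms(1,2)]]
    by (simp add: open_map_def)
  then show ?thesis
    using openin_open_subtopology[OF complex_manifold_chart(2)[OF assms(1,2)]] by simp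
qed

lemma over_Int: "over L (A \<inter> B) = over L A \<inter> over L B"
  by (auto simp: over_def)

lemma over_mono: "A \<subseteq> B \<Longrightarrow> over L A \<subseteq> over L B"
  by (auto simp: over_def)

locale line_bundle_on_manifold =
  fixes L :: "('a, 'b) line_bundle"
  assumes base: "complex_manifold (lb_base L)"
    and line_bundle: "holomorphic_line_bundle L"
begin

abbreviation "dim_base \<equiv> mdim (lb_base L)"

abbreviation total_chart :: "('a \<Rightarrow> nat \<Rightarrow> complex) \<Rightarrow> ('b \<Rightarrow> complex) \<Rightarrow> 'b \<Rightarrow> nat \<Rightarrow> complex" where
  "total_chart \<phi> \<tau> \<equiv> \<lambda>p. (\<phi> (lb_proj L p))(dim_base := \<tau> p)"

lemma inj_charts_base: "inj_charts (lb_base L)"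
  by (rule complex_manifold_inj_charts[OF base])

lemma openin_over:
  assumes "openin (mtop (lb_base L)) W"
  shows "openin (lb_top L) (over L W)"
proof -
  have "continuous_map (lb_top L) (mtop (lb_base L)) (lb_proj L)"
    using line_bundle by (simp add: holomorphic_line_bundle_def)
  from openin_continuous_map_preimage[OF this assms] show ?thesis
    by (simp add: over_def)
qed

lemma triv_open:
  assumes "(U, \<tau>) \<in> lb_trivs L"
  shows "openin (mtop (lb_base L)) U"
  using line_bundle assms unfolding holomorphic_line_bundle_def by blast

lemma triv_bij:
  assumes "(U, \<tau>) \<in> lb_trivs L"
  shows "bij_betw (\<lambda>p. (lb_proj L p, \<tau> p)) (over L U) (U \<times> UNIV)"
proof -
  have U: "U \<subseteq> topspace (mtop (lb_base L))"
    by (rule openin_subset[OF triv_open[OF assms]])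
  have h: "homeomorphic_map (subtopology (lb_top L) (over L U))
          (prod_topology (subtopology (mtop (lb_base L)) U) euclidean) (\<lambda>p. (lb_proj L p, \<tau> p))"
    using line_bundle assms unfolding holomorphic_line_bundle_def by blast
  have "topspace (lb_top L) \<inter> over L U = over L U"
    by (auto simp: over_def)
  then show ?thesis
    using homeomorphic_imp_injective_map[OF h] homeomorphic_imp_surjective_map[OF h] U
    by (simp add: bij_betw_def Int_absorb1)
qed

lemma triv_point:
  assumes "(U, \<tau>) \<in> lb_trivs L" "x \<in> U"
  obtains p where "p \<in> over L U" "lb_proj L p = x" "\<tau> p = w"
proof -
  have "(x, w) \<in> (\<lambda>p. (lb_proj L p, \<tau> p)) ` over L U"
    using bij_betw_imp_surj_on[OF triv_bij[OF assms(1)]] assms(2) by simp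
  then show thesis
    using that by auto
qed

lemma triv_inj:
  assumes "(U, \<tau>) \<in> lb_trivs L" "p \<in> over L U" "q \<in> over L U" "lb_proj L p = lb_proj L q" "\<tau> p = \<tau> q"
  shows "p = q"
  by (rule inj_onD[OF bij_betw_imp_inj_on[OF triv_bij[OF assms(1)]] _ assms(2,3)]) (simp add: assms(4,5))

lemma chart_coordinate:
  assumes "(U, \<phi>) \<in> matlas (lb_base L)" "x \<in> U" "i \<ge> dim_base"
  shows "\<phi> x i = 0"
proof -
  have "\<phi> ` U \<subseteq> {z. \<forall>i\<ge>dim_base. z i = 0}"
    using openin_subset[OF complex_manifold_chart(2)[OF base assms(1)]]
    by (simp add: topspace_complex_space)
  then show ?thesis
    using assms(2,3) by blast
qed

text \<open>Base charts take the value 0 in slot \<open>dim_base\<close>, so that slot is free to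
  hold the fibre coordinate and clearing it loses nothing.\<close>

lemma chart_drop_coordinate:
  assumes "(U, \<phi>) \<in> matlas (lb_base L)" "x \<in> U"
  shows "(\<phi> x)(dim_base := t, dim_base := 0) = \<phi> x"
  using chart_coordinate[OF assms, of dim_base] by auto

lemma total_atlasE:
  assumes "(A, \<psi>) \<in> matlas (total_space L)"
  obtains U \<phi> U' \<tau> where "(U, \<phi>) \<in> matlas (lb_base L)" "(U', \<tau>) \<in> lb_trivs L"
    "A = over L (U \<inter> U')" "\<psi> = total_chart \<phi> \<tau>"
  using assms unfolding total_space_def by auto

lemma total_chart_mem:
  assumes "(U, \<phi>) \<in> matlas (lb_base L)" "(U', \<tau>) \<in> lb_trivs L"
  shows "(over L (U \<inter> U'), total_chart \<phi> \<tau>) \<in> matlas (total_space L)"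
  using assms unfolding total_space_def by auto

lemma mdim_total [simp]: "mdim (total_space L) = Suc dim_base"
  and mtop_total [simp]: "mtop (total_space L) = lb_top L"
  by (simp_all add: total_space_def)

lemma total_chart_inj:
  assumes "(U, \<phi>) \<in> matlas (lb_base L)" "(U', \<tau>) \<in> lb_trivs L"
  shows "inj_on (total_chart \<phi> \<tau>) (over L (U \<inter> U'))"
proof (rule inj_onI)
  fix p q assume pq: "p \<in> over L (U \<inter> U')" "q \<in> over L (U \<inter> U')"
    and eq: "total_chart \<phi> \<tau> p = total_chart \<phi> \<tau> q"
  have mem: "lb_proj L p \<in> U" "lb_proj L q \<in> U" "p \<in> over L U'" "q \<in> over L U'"
    using pq by (auto simp: over_def)
  have "\<phi> (lb_proj L p) = \<phi> (lb_proj L q)"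
    using arg_cong[OF eq, of "\<lambda>z. z(dim_base := 0)"]
    unfolding chart_drop_coordinate[OF assms(1) mem(1)] chart_drop_coordinate[OF assms(1) mem(2)] .
  then have "lb_proj L p = lb_proj L q"
    using inj_onD[OF inj_chartsD[OF inj_charts_base assms(1)]] mem by blast
  moreover have "\<tau> p = \<tau> q"
    using fun_cong[OF eq, of dim_base] by simp
  ultimately show "p = q"
    using triv_inj[OF assms(2)] mem by blast
qed

lemma inj_charts_total: "inj_charts (total_space L)"
proof -
  have "inj_on \<psi> A" if A: "(A, \<psi>) \<in> matlas (total_space L)" for A \<psi>
    using A by (rule total_atlasE) (simp add: total_chart_inj)
  then show ?thesis
    by (auto simp: inj_charts_def)
qed

text \<open>The inclusion from right to left rests on surjectivity of the trivialisation: every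
  complex number occurs as fibre coordinate over every point of \<open>W\<close>.\<close>

lemma total_chart_image:
  assumes "(U, \<phi>) \<in> matlas (lb_base L)" "(U', \<tau>) \<in> lb_trivs L" "W \<subseteq> U \<inter> U'"
  shows "total_chart \<phi> \<tau> ` over L W = cylinder dim_base (\<phi> ` W)"
proof (intro equalityI subsetI)
  fix z assume "z \<in> total_chart \<phi> \<tau> ` over L W"
  then obtain p where p: "p \<in> over L W" "z = total_chart \<phi> \<tau> p"
    by blast
  then have "lb_proj L p \<in> W" "lb_proj L p \<in> U"
    using assms(3) by (auto simp: over_def)
  then show "z \<in> cylinder dim_base (\<phi> ` W)"
    using chart_drop_coordinate[OF assms(1)] chart_coordinate[OF assms(1)] p(2)
    by (simp add: cylinder_def topspace_complex_space)
next
  fix z assume z: "z \<in> cylinder dim_base (\<phi> ` W)"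
  then obtain x where x: "x \<in> W" "z(dim_base := 0) = \<phi> x"
    by (auto simp: cylinder_def)
  obtain p where p: "p \<in> over L U'" "lb_proj L p = x" "\<tau> p = z dim_base"
    using triv_point[OF assms(2)] x(1) assms(3) by blast
  have "z = total_chart \<phi> \<tau> p"
    unfolding p(2,3) x(2)[symmetric] by simp
  moreover have "p \<in> over L W"
    using p x(1) by (simp add: over_def)
  ultimately show "z \<in> total_chart \<phi> \<tau> ` over L W"
    by blast
qed

section \<open>Holomorphic functions on the total space\<close>

text \<open>Holomorphy is tested by exhibiting a local expression \<open>G\<close> on a cylinder,
  which avoids computing with inverses of the charts of the total space.\<close>

lemma structure_sheaf_totalI:
  assumes W: "openin (mtop (lb_base L)) W"
    and loc: "\<And>U \<phi> U' \<tau>. (U, \<phi>) \<in> matlas (lb_base L) \<Longrightarrow> (U', \<tau>) \<in> lb_trivs L \<Longrightarrow>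
      \<exists>G. holomorphic_fun (Suc dim_base) (cylinder dim_base (\<phi> ` (U \<inter> U' \<inter> W))) G \<and>
        (\<forall>p\<in>over L (U \<inter> U' \<inter> W). F p = G (total_chart \<phi> \<tau> p))"
  shows "F \<in> structure_sheaf (total_space L) (over L W)"
proof -
  have "holomorphic_fun (Suc dim_base) (\<psi> ` (A \<inter> over L W)) (F \<circ> inv_into A \<psi>)"
    if A: "(A, \<psi>) \<in> matlas (total_space L)" for A \<psi>
  proof -
    obtain U \<phi> U' \<tau> where c: "(U, \<phi>) \<in> matlas (lb_base L)" "(U', \<tau>) \<in> lb_trivs L"
      "A = over L (U \<inter> U')" "\<psi> = total_chart \<phi> \<tau>"
      using A by (rule total_atlasE)
    obtain G where G: "holomorphic_fun (Suc dim_base) (cylinder dim_base (\<phi> ` (U \<inter> U' \<inter> W))) G"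
      "\<And>p. p \<in> over L (U \<inter> U' \<inter> W) \<Longrightarrow> F p = G (total_chart \<phi> \<tau> p)"
      using loc[OF c(1,2)] by blast
    have img: "\<psi> ` (A \<inter> over L W) = cylinder dim_base (\<phi> ` (U \<inter> U' \<inter> W))"
      unfolding c(3,4) over_Int[symmetric] by (rule total_chart_image[OF c(1,2)]) blast
    show ?thesis
    proof (rule holomorphic_fun_cong)
      show "holomorphic_fun (Suc dim_base) (\<psi> ` (A \<inter> over L W)) G"
        unfolding img by (rule G(1))
      fix z assume "z \<in> \<psi> ` (A \<inter> over L W)"
      then obtain p where p: "p \<in> A" "p \<in> over L W" "z = \<psi> p"
        by blast
      have "inv_into A \<psi> z = p"
        using inj_chartsD[OF inj_charts_total A] p by simp
      moreover have "F p = G z"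
        using G(2)[of p] p unfolding c(3,4) by (simp add: over_Int)
      ultimately show "G z = (F \<circ> inv_into A \<psi>) z"
        by simp
    qed
  qed
  then show ?thesis
    using openin_over[OF W] by (auto simp: structure_sheaf_def)
qed

lemma structure_sheaf_chart_cylinder:
  assumes "a \<in> structure_sheaf (lb_base L) W" "(U, \<phi>) \<in> matlas (lb_base L)"
    "openin (mtop (lb_base L)) W'" "W' \<subseteq> U \<inter> W"
  shows "holomorphic_fun (Suc dim_base) (cylinder dim_base (\<phi> ` W'))
    (\<lambda>z. a (inv_into U \<phi> (z(dim_base := 0))))"
proof -
  have "holomorphic_fun dim_base (\<phi> ` (U \<inter> W)) (a \<circ> inv_into U \<phi>)"
    using assms(1,2) by (auto simp: structure_sheaf_def)
  moreover have "openin (complex_space dim_base) (\<phi> ` W')"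
    using complex_manifold_open_chart[OF base assms(2,3)] assms(4) by blast
  moreover have "\<phi> ` W' \<subseteq> \<phi> ` (U \<inter> W)"
    using assms(4) by blast
  ultimately have "holomorphic_fun dim_base (\<phi> ` W') (a \<circ> inv_into U \<phi>)"
    by (rule holomorphic_fun_subset)
  from holomorphic_fun_cylinder[OF this] show ?thesis
    by (simp add: comp_def)
qed

lemma chart_inverse_total_chart:
  assumes "(U, \<phi>) \<in> matlas (lb_base L)" "lb_proj L p \<in> U"
  shows "inv_into U \<phi> ((total_chart \<phi> \<tau> p)(dim_base := 0)) = lb_proj L p"
  unfolding chart_drop_coordinate[OF assms]
  by (rule inv_into_f_f[OF inj_chartsD[OF inj_charts_base assms(1)] assms(2)])

lemma openin_chart_triv:
  assumes "(U, \<phi>) \<in> matlas (lb_base L)" "(U', \<tau>) \<in> lb_trivs L" "openin (mtop (lb_base L)) W"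
  shows "openin (mtop (lb_base L)) (U \<inter> U' \<inter> W)"
  by (intro openin_Int complex_manifold_chart(1)[OF base assms(1)] triv_open[OF assms(2)] assms(3))

lemma structure_sheaf_pullback:
  assumes "a \<in> structure_sheaf (lb_base L) W"
  shows "a \<circ> lb_proj L \<in> structure_sheaf (total_space L) (over L W)"
proof (rule structure_sheaf_totalI)
  show W: "openin (mtop (lb_base L)) W"
    using assms by (simp add: structure_sheaf_def)
  fix U \<phi> U' \<tau> assume c: "(U, \<phi>) \<in> matlas (lb_base L)" "(U', \<tau>) \<in> lb_trivs L"
  have "holomorphic_fun (Suc dim_base) (cylinder dim_base (\<phi> ` (U \<inter> U' \<inter> W)))
    (\<lambda>z. a (inv_into U \<phi> (z(dim_base := 0))))"
    by (rule structure_sheaf_chart_cylinder[OF assms c(1) openin_chart_triv[OF c W]]) blast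
  moreover have "\<forall>p\<in>over L (U \<inter> U' \<inter> W).
      (a \<circ> lb_proj L) p = a (inv_into U \<phi> ((total_chart \<phi> \<tau> p)(dim_base := 0)))"
    using chart_inverse_total_chart[OF c(1)] by (simp add: over_def)
  ultimately show "\<exists>G. holomorphic_fun (Suc dim_base) (cylinder dim_base (\<phi> ` (U \<inter> U' \<inter> W))) G \<and>
      (\<forall>p\<in>over L (U \<inter> U' \<inter> W). (a \<circ> lb_proj L) p = G (total_chart \<phi> \<tau> p))"
    by (intro exI conjI)
qed

text \<open>In any other trivialisation the coordinate is a transition function from the base times
  the fibre coordinate there, that is, times coordinate number \<open>dim_base\<close>.\<close>

lemma structure_sheaf_fibre_coordinate:
  assumes T: "(U0, \<tau>0) \<in> lb_trivs L"
  shows "\<tau>0 \<in> structure_sheaf (total_space L) (over L U0)"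
proof (rule structure_sheaf_totalI[OF triv_open[OF T]])
  fix U \<phi> U' \<tau> assume c: "(U, \<phi>) \<in> matlas (lb_base L)" "(U', \<tau>) \<in> lb_trivs L"
  obtain g where g: "g \<in> structure_sheaf (lb_base L) (U' \<inter> U0)"
    "\<And>p. p \<in> over L (U' \<inter> U0) \<Longrightarrow> \<tau>0 p = g (lb_proj L p) * \<tau> p"
    using line_bundle c(2) T unfolding holomorphic_line_bundle_def by fast
  let ?A = "U \<inter> U' \<inter> U0"
  have A: "openin (mtop (lb_base L)) ?A"
    by (rule openin_chart_triv[OF c triv_open[OF T]])
  have hol: "holomorphic_fun (Suc dim_base) (cylinder dim_base (\<phi> ` ?A))
    (\<lambda>z. g (inv_into U \<phi> (z(dim_base := 0))))"
    by (rule structure_sheaf_chart_cylinder[OF g(1) c(1) A]) blast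
  have "openin (complex_space (Suc dim_base)) (cylinder dim_base (\<phi> ` ?A))"
    using hol by (simp add: holomorphic_fun_iff)
  from holomorphic_fun_mult[OF hol holomorphic_fun_coordinate[OF this, of dim_base]]
  have "holomorphic_fun (Suc dim_base) (cylinder dim_base (\<phi> ` ?A))
    (\<lambda>z. g (inv_into U \<phi> (z(dim_base := 0))) * z dim_base)" .
  moreover have "\<forall>p\<in>over L ?A. \<tau>0 p =
      g (inv_into U \<phi> ((total_chart \<phi> \<tau> p)(dim_base := 0))) * total_chart \<phi> \<tau> p dim_base"
  proof
    fix p assume "p \<in> over L ?A"
    then have p: "lb_proj L p \<in> U" "p \<in> over L (U' \<inter> U0)"
      by (simp_all add: over_def)
    show "\<tau>0 p = g (inv_into U \<phi> ((total_chart \<phi> \<tau> p)(dim_base := 0))) * total_chart \<phi> \<tau> p dim_base"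
      unfolding chart_inverse_total_chart[OF c(1) p(1)] using g(2)[OF p(2)] by simp
  qed
  ultimately show "\<exists>G. holomorphic_fun (Suc dim_base) (cylinder dim_base (\<phi> ` ?A)) G \<and>
      (\<forall>p\<in>over L ?A. \<tau>0 p = G (total_chart \<phi> \<tau> p))"
    by (intro exI conjI)
qed

lemma one_structure_sheaf_total:
  assumes W: "openin (mtop (lb_base L)) W"
  shows "1 \<in> structure_sheaf (total_space L) (over L W)"
proof -
  have "1 \<in> structure_sheaf (lb_base L) W"
  proof -
    have "holomorphic_fun dim_base (\<phi> ` (U \<inter> W)) (1 \<circ> inv_into U \<phi>)"
      if c: "(U, \<phi>) \<in> matlas (lb_base L)" for U \<phi>
    proof -
      have "openin (complex_space dim_base) (\<phi> ` (U \<inter> W))"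
        using complex_manifold_open_chart[OF base c openin_Int[OF complex_manifold_chart(1)[OF base c] W]]
        by blast
      then show ?thesis
        using holomorphic_fun_const[of dim_base _ 1] by (simp add: comp_def)
    qed
    then show ?thesis
      using W by (auto simp: structure_sheaf_def)
  qed
  from structure_sheaf_pullback[OF this] show ?thesis
    by (simp add: comp_def one_fun_def)
qed

text \<open>If \<open>h\<close> is a multiple of the j-th power of the fibre coordinate with
  cofactor \<open>g\<close>, then \<open>m * h\<close> is one with cofactor \<open>m * g\<close>; so
  all powers of the ideal are preserved.\<close>

lemma mult_V0_operator:
  assumes m: "m \<in> structure_sheaf (total_space L) Q0"
    and W: "openin (mtop (lb_base L)) W" "over L W \<subseteq> Q0"
  shows "(\<lambda>h. m * h) \<in> V0_operators L (over L W)"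
proof -
  have "m * h \<in> zero_section_ideal_power L j Q"
    if Q: "Q \<subseteq> over L W" and h: "h \<in> zero_section_ideal_power L j Q" for Q j h
  proof -
    have Q0: "Q0 \<inter> Q = Q"
      using Q W(2) by blast
    have "m * h \<in> structure_sheaf (total_space L) Q"
      using structure_sheaf_mult[OF inj_charts_total m, of h Q] h
      by (simp add: zero_section_ideal_power_def Q0)
    moreover have "\<exists>g\<in>structure_sheaf (total_space L) (Q \<inter> over L U).
        \<forall>p\<in>Q \<inter> over L U. (m * h) p = \<tau> p ^ j * g p" if T: "(U, \<tau>) \<in> lb_trivs L" for U \<tau>
    proof -
      obtain g where g: "g \<in> structure_sheaf (total_space L) (Q \<inter> over L U)"
        "\<And>p. p \<in> Q \<inter> over L U \<Longrightarrow> h p = \<tau> p ^ j * g p"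
        using h T unfolding zero_section_ideal_power_def by blast
      have "m * g \<in> structure_sheaf (total_space L) (Q \<inter> over L U)"
        using structure_sheaf_mult[OF inj_charts_total m g(1)] by (simp add: Int_assoc[symmetric] Q0)
      moreover have "(m * h) p = \<tau> p ^ j * (m * g) p" if "p \<in> Q \<inter> over L U" for p
        using g(2)[OF that] by simp
      ultimately show ?thesis
        by blast
    qed
    ultimately show ?thesis
      unfolding zero_section_ideal_power_def by blast
  qed
  then show ?thesis
    using mult_diff_operator[OF inj_charts_total m one_structure_sheaf_total[OF W(1)] W(2)]
    unfolding V0_operators_def by blast
qed

section \<open>Right multiplication on the direct image\<close>

text \<open>Operators are total functions on representatives, so the Leibniz rule below holds only for
  arguments that are holomorphic near the point of evaluation; hence equality is taken up to \<open>agree_on\<close>.\<close>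

definition agree_on ::
  "('a \<Rightarrow> 'b) \<Rightarrow> 'b set \<Rightarrow> ('a, 'b) form_operator \<Rightarrow> ('a, 'b) form_operator \<Rightarrow> bool" where
  "agree_on s Q \<Psi> \<Phi> \<longleftrightarrow> (\<forall>Q'. \<forall>h\<in>structure_sheaf (total_space L) Q'.
     \<forall>c\<in>matlas (lb_base L). \<forall>x\<in>preim L s (Q \<inter> Q') \<inter> fst c. \<Psi> h c x = \<Phi> h c x)"

lemma agree_onD:
  assumes "agree_on s Q \<Psi> \<Phi>" "h \<in> structure_sheaf (total_space L) Q'" "c \<in> matlas (lb_base L)"
    "x \<in> preim L s Q" "s x \<in> Q'" "x \<in> fst c"
  shows "\<Psi> h c x = \<Phi> h c x"
proof -
  have "x \<in> preim L s (Q \<inter> Q') \<inter> fst c"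
    using assms(4-6) by (simp add: preim_def)
  then show ?thesis
    using assms(1)[unfolded agree_on_def, rule_format, OF assms(2,3)] by (simp only:)
qed

lemma form_operatorsD:
  assumes "\<Psi> \<in> form_operators L s Q"
  shows "openin (lb_top L) Q"
    and "c \<in> matlas (lb_base L) \<Longrightarrow>
      (\<lambda>h. \<Psi> h c) \<in> diff_operators (total_space L) (lb_base L) s (preim L s Q \<inter> fst c)"
    and "h \<in> structure_sheaf (total_space L) Q' \<Longrightarrow> c \<in> matlas (lb_base L) \<Longrightarrow>
      c' \<in> matlas (lb_base L) \<Longrightarrow> x \<in> preim L s (Q \<inter> Q') \<inter> fst c \<inter> fst c' \<Longrightarrow>
      \<Psi> h c x = jacobian (lb_base L) c c' x * \<Psi> h c' x"
proof -
  note \<Psi> = assms[unfolded form_operators_def mem_Collect_eq]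
  show "openin (lb_top L) Q"
    by (rule \<Psi>[THEN conjunct1])
  show "(\<lambda>h. \<Psi> h c) \<in> diff_operators (total_space L) (lb_base L) s (preim L s Q \<inter> fst c)"
    if "c \<in> matlas (lb_base L)"
    by (rule \<Psi>[THEN conjunct2, THEN conjunct1, rule_format, OF that])
  show "\<Psi> h c x = jacobian (lb_base L) c c' x * \<Psi> h c' x"
    if "h \<in> structure_sheaf (total_space L) Q'" "c \<in> matlas (lb_base L)"
      "c' \<in> matlas (lb_base L)" "x \<in> preim L s (Q \<inter> Q') \<inter> fst c \<inter> fst c'"
    by (rule \<Psi>[THEN conjunct2, THEN conjunct2, rule_format, OF that])
qed

lemma form_operatorsI:
  assumes "openin (lb_top L) Q"
    and "\<And>c. c \<in> matlas (lb_base L) \<Longrightarrow>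
      (\<lambda>h. \<Psi> h c) \<in> diff_operators (total_space L) (lb_base L) s (preim L s Q \<inter> fst c)"
    and "\<And>Q' h c c' x. h \<in> structure_sheaf (total_space L) Q' \<Longrightarrow> c \<in> matlas (lb_base L) \<Longrightarrow>
      c' \<in> matlas (lb_base L) \<Longrightarrow> x \<in> preim L s (Q \<inter> Q') \<inter> fst c \<inter> fst c' \<Longrightarrow>
      \<Psi> h c x = jacobian (lb_base L) c c' x * \<Psi> h c' x"
  shows "\<Psi> \<in> form_operators L s Q"
  unfolding form_operators_def mem_Collect_eq
  by (intro conjI allI ballI assms(1)) (rule assms(2) assms(3); assumption)+

lemma form_operators_cong:
  assumes "\<Psi> \<in> form_operators L s Q" "agree_on s Q \<Psi> \<Phi>"
  shows "\<Phi> \<in> form_operators L s Q"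
proof (rule form_operatorsI)
  fix c assume c: "c \<in> matlas (lb_base L)"
  show "(\<lambda>h. \<Phi> h c) \<in> diff_operators (total_space L) (lb_base L) s (preim L s Q \<inter> fst c)"
  proof (rule diff_operators_cong[OF inj_charts_base inj_charts_total form_operatorsD(2)[OF assms(1) c]])
    fix Q' h x
    assume h: "h \<in> structure_sheaf (total_space L) Q'" and "x \<in> preim L s Q \<inter> fst c" and s: "s x \<in> Q'"
    then have x: "x \<in> preim L s Q" "x \<in> fst c"
      by simp_all
    show "\<Psi> h c x = \<Phi> h c x"
      by (rule agree_onD[OF assms(2) h c x(1) s x(2)])
  qed
next
  fix Q' h c c' x
  assume h: "h \<in> structure_sheaf (total_space L) Q'" and c: "c \<in> matlas (lb_base L)" "c' \<in> matlas (lb_base L)"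
    and x: "x \<in> preim L s (Q \<inter> Q') \<inter> fst c \<inter> fst c'"
  then have x': "x \<in> preim L s Q" "s x \<in> Q'" "x \<in> fst c" "x \<in> fst c'"
    by (simp_all add: preim_def)
  show "\<Phi> h c x = jacobian (lb_base L) c c' x * \<Phi> h c' x"
    using form_operatorsD(3)[OF assms(1) h c x]
    unfolding agree_onD[OF assms(2) h c(1) x'(1-3)] agree_onD[OF assms(2) h c(2) x'(1,2,4)] .
qed (rule form_operatorsD(1)[OF assms(1)])

lemma form_operators_comp_mult:
  assumes m: "m \<in> structure_sheaf (total_space L) Q0"
    and \<Psi>: "\<Psi> \<in> form_operators L s Q" and Q: "Q \<subseteq> Q0"
  shows "\<Psi> \<circ> (\<lambda>h. m * h) \<in> form_operators L s Q"
proof (rule form_operatorsI)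
  fix c assume c: "c \<in> matlas (lb_base L)"
  have "preim L s Q \<inter> fst c \<subseteq> s -` Q0"
    using Q by (auto simp: preim_def)
  from diff_operators_comp_mult[OF inj_charts_total m form_operatorsD(2)[OF \<Psi> c] this]
  show "(\<lambda>h. (\<Psi> \<circ> (\<lambda>h. m * h)) h c) \<in> diff_operators (total_space L) (lb_base L) s (preim L s Q \<inter> fst c)"
    unfolding comp_def .
next
  fix Q' h c c' x
  assume h: "h \<in> structure_sheaf (total_space L) Q'" and c: "c \<in> matlas (lb_base L)" "c' \<in> matlas (lb_base L)"
    and "x \<in> preim L s (Q \<inter> Q') \<inter> fst c \<inter> fst c'"
  then have x: "x \<in> preim L s (Q \<inter> (Q0 \<inter> Q')) \<inter> fst c \<inter> fst c'"
    using Q by (auto simp: preim_def)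
  show "(\<Psi> \<circ> (\<lambda>h. m * h)) h c x = jacobian (lb_base L) c c' x * (\<Psi> \<circ> (\<lambda>h. m * h)) h c' x"
    unfolding comp_def
    by (rule form_operatorsD(3)[OF \<Psi> structure_sheaf_mult[OF inj_charts_total m h] c x])
qed (rule form_operatorsD(1)[OF \<Psi>])

section \<open>Compatibility with the relations of the tensor product\<close>

lemma tensor_relationsE:
  assumes "\<Psi> \<in> tensor_relations L s Q" "x \<in> preim L s Q"
  obtains c W P where "c \<in> matlas (lb_base L)" "openin (mtop (lb_base L)) W" "x \<in> W"
    "W \<subseteq> preim L s Q \<inter> fst c"
    "\<forall>i<dim_base. P i \<in> diff_operators (total_space L) (lb_base L) s W"
    "\<forall>Q'. \<forall>h\<in>structure_sheaf (total_space L) Q'. \<forall>y\<in>W \<inter> s -` Q'.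
       \<Psi> h c y = (\<Sum>i<dim_base. chart_deriv c i (P i h) y)"
  using assms(1)[unfolded tensor_relations_def mem_Collect_eq, THEN conjunct2, rule_format, OF assms(2)]
  by (elim bexE exE conjE)

lemma tensor_relationsI:
  assumes "\<Psi> \<in> form_operators L s Q"
    and "\<And>x. x \<in> preim L s Q \<Longrightarrow> \<exists>c\<in>matlas (lb_base L). \<exists>W P.
       openin (mtop (lb_base L)) W \<and> x \<in> W \<and> W \<subseteq> preim L s Q \<inter> fst c \<and>
       (\<forall>i<dim_base. P i \<in> diff_operators (total_space L) (lb_base L) s W) \<and>
       (\<forall>Q'. \<forall>h\<in>structure_sheaf (total_space L) Q'. \<forall>y\<in>W \<inter> s -` Q'.
          \<Psi> h c y = (\<Sum>i<dim_base. chart_deriv c i (P i h) y))"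
  shows "\<Psi> \<in> tensor_relations L s Q"
  unfolding tensor_relations_def mem_Collect_eq by (intro conjI ballI assms)

lemma tensor_relations_form_operators:
  "\<Psi> \<in> tensor_relations L s Q \<Longrightarrow> \<Psi> \<in> form_operators L s Q"
  unfolding tensor_relations_def mem_Collect_eq by (erule conjunct1)

lemma tensor_relations_cong:
  assumes "\<Psi> \<in> tensor_relations L s Q" "agree_on s Q \<Psi> \<Phi>"
  shows "\<Phi> \<in> tensor_relations L s Q"
proof (rule tensor_relationsI)
  show "\<Phi> \<in> form_operators L s Q"
    by (rule form_operators_cong[OF tensor_relations_form_operators[OF assms(1)] assms(2)])
  fix x assume "x \<in> preim L s Q"
  with assms(1) obtain c W P where r: "c \<in> matlas (lb_base L)" "openin (mtop (lb_base L)) W" "x \<in> W"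
    "W \<subseteq> preim L s Q \<inter> fst c"
    "\<forall>i<dim_base. P i \<in> diff_operators (total_space L) (lb_base L) s W"
    "\<forall>Q'. \<forall>h\<in>structure_sheaf (total_space L) Q'. \<forall>y\<in>W \<inter> s -` Q'.
       \<Psi> h c y = (\<Sum>i<dim_base. chart_deriv c i (P i h) y)"
    by (rule tensor_relationsE)
  have "\<Phi> h c y = (\<Sum>i<dim_base. chart_deriv c i (P i h) y)"
    if h: "h \<in> structure_sheaf (total_space L) Q'" "y \<in> W \<inter> s -` Q'" for Q' h y
  proof -
    have y: "y \<in> preim L s Q" "s y \<in> Q'" "y \<in> fst c"
      using h(2) r(4) by auto
    show ?thesis
      using r(6)[rule_format, OF h] unfolding agree_onD[OF assms(2) h(1) r(1) y] .
  qed
  then show "\<exists>c\<in>matlas (lb_base L). \<exists>W P.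
       openin (mtop (lb_base L)) W \<and> x \<in> W \<and> W \<subseteq> preim L s Q \<inter> fst c \<and>
       (\<forall>i<dim_base. P i \<in> diff_operators (total_space L) (lb_base L) s W) \<and>
       (\<forall>Q'. \<forall>h\<in>structure_sheaf (total_space L) Q'. \<forall>y\<in>W \<inter> s -` Q'.
          \<Phi> h c y = (\<Sum>i<dim_base. chart_deriv c i (P i h) y))"
    by (intro bexI[OF _ r(1)] exI[of _ W] exI[of _ P] conjI r(2-5) allI impI ballI)
qed

text \<open>The derivatives in a relation act on the values of the operators \<open>P i\<close>,
  whereas \<open>m\<close> acts on their arguments. Replacing each \<open>P i\<close> by its
  composition with \<open>m\<close> thus gives a relation again, so right multiplication is well
  defined on the quotient M.\<close>

lemma tensor_relations_comp_mult:
  assumes m: "m \<in> structure_sheaf (total_space L) Q0"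
    and \<Psi>: "\<Psi> \<in> tensor_relations L s Q" and Q: "Q \<subseteq> Q0"
  shows "\<Psi> \<circ> (\<lambda>h. m * h) \<in> tensor_relations L s Q"
proof (rule tensor_relationsI)
  show "\<Psi> \<circ> (\<lambda>h. m * h) \<in> form_operators L s Q"
    by (rule form_operators_comp_mult[OF m tensor_relations_form_operators[OF \<Psi>] Q])
  fix x assume "x \<in> preim L s Q"
  with \<Psi> obtain c W P where r: "c \<in> matlas (lb_base L)" "openin (mtop (lb_base L)) W" "x \<in> W"
    "W \<subseteq> preim L s Q \<inter> fst c"
    "\<forall>i<dim_base. P i \<in> diff_operators (total_space L) (lb_base L) s W"
    "\<forall>Q'. \<forall>h\<in>structure_sheaf (total_space L) Q'. \<forall>y\<in>W \<inter> s -` Q'.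
       \<Psi> h c y = (\<Sum>i<dim_base. chart_deriv c i (P i h) y)"
    by (rule tensor_relationsE)
  have W: "W \<subseteq> s -` Q0"
    using r(4) Q by (auto simp: preim_def)
  have P: "P i \<circ> (\<lambda>h. m * h) \<in> diff_operators (total_space L) (lb_base L) s W" if "i < dim_base" for i
    by (rule diff_operators_comp_mult[OF inj_charts_total m r(5)[rule_format, OF that] W])
  have "(\<Psi> \<circ> (\<lambda>h. m * h)) h c y = (\<Sum>i<dim_base. chart_deriv c i ((P i \<circ> (\<lambda>h. m * h)) h) y)"
    if h: "h \<in> structure_sheaf (total_space L) Q'" and "y \<in> W \<inter> s -` Q'" for Q' h y
  proof -
    have y: "y \<in> W \<inter> s -` (Q0 \<inter> Q')"
      using that(2) W by auto
    show ?thesis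
      unfolding comp_def by (rule r(6)[rule_format, OF structure_sheaf_mult[OF inj_charts_total m h] y])
  qed
  then show "\<exists>c\<in>matlas (lb_base L). \<exists>W P.
       openin (mtop (lb_base L)) W \<and> x \<in> W \<and> W \<subseteq> preim L s Q \<inter> fst c \<and>
       (\<forall>i<dim_base. P i \<in> diff_operators (total_space L) (lb_base L) s W) \<and>
       (\<forall>Q'. \<forall>h\<in>structure_sheaf (total_space L) Q'. \<forall>y\<in>W \<inter> s -` Q'.
          (\<Psi> \<circ> (\<lambda>h. m * h)) h c y = (\<Sum>i<dim_base. chart_deriv c i (P i h) y))"
    by (intro bexI[OF _ r(1)] exI[of _ W] exI[of _ "\<lambda>i. P i \<circ> (\<lambda>h. m * h)"] conjI r(2-4) allI impI P ballI)
qed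

section \<open>Compatibility with the Hodge filtration\<close>

lemma hodge_filtrationE:
  assumes "\<Psi> \<in> hodge_filtration L s p Q" "q \<in> Q"
  obtains Q' \<Phi> where "\<Phi> \<in> form_operators L s Q'" "q \<in> Q'" "Q' \<subseteq> Q"
    "\<forall>c\<in>matlas (lb_base L). order_less (total_space L) s (nat (p + int dim_base + 1))
            (preim L s Q' \<inter> fst c) (\<lambda>h. \<Phi> h c)"
    "\<Psi> - \<Phi> \<in> tensor_relations L s Q'"
  using assms(1)[unfolded hodge_filtration_def image_eq_def mem_Collect_eq, THEN conjunct2, rule_format, OF assms(2)]
  by (elim bexE exE conjE)

lemma hodge_filtrationI:
  assumes "\<Psi> \<in> form_operators L s Q"
    and "\<And>q. q \<in> Q \<Longrightarrow> \<exists>Q'. \<exists>\<Phi>\<in>form_operators L s Q'. q \<in> Q' \<and> Q' \<subseteq> Q \<and>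
       (\<forall>c\<in>matlas (lb_base L). order_less (total_space L) s (nat (p + int dim_base + 1))
            (preim L s Q' \<inter> fst c) (\<lambda>h. \<Phi> h c)) \<and>
       image_eq L s Q' \<Psi> \<Phi>"
  shows "\<Psi> \<in> hodge_filtration L s p Q"
  unfolding hodge_filtration_def mem_Collect_eq by (intro conjI ballI assms)

lemma hodge_filtration_form_operators:
  "\<Psi> \<in> hodge_filtration L s p Q \<Longrightarrow> \<Psi> \<in> form_operators L s Q"
  unfolding hodge_filtration_def mem_Collect_eq by (erule conjunct1)

text \<open>The low-order representative \<Phi> is kept; only the relation \<Psi> - \<Phi> is
  transported.\<close>

lemma hodge_filtration_cong:
  assumes "\<Psi> \<in> hodge_filtration L s p Q" "agree_on s Q \<Psi> \<Psi>'"
  shows "\<Psi>' \<in> hodge_filtration L s p Q"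
proof (rule hodge_filtrationI)
  show "\<Psi>' \<in> form_operators L s Q"
    by (rule form_operators_cong[OF hodge_filtration_form_operators[OF assms(1)] assms(2)])
  fix q assume "q \<in> Q"
  with assms(1) obtain Q' \<Phi> where r: "\<Phi> \<in> form_operators L s Q'" "q \<in> Q'" "Q' \<subseteq> Q"
    "\<forall>c\<in>matlas (lb_base L). order_less (total_space L) s (nat (p + int dim_base + 1))
            (preim L s Q' \<inter> fst c) (\<lambda>h. \<Phi> h c)"
    "\<Psi> - \<Phi> \<in> tensor_relations L s Q'"
    by (rule hodge_filtrationE)
  have "agree_on s Q' (\<Psi> - \<Phi>) (\<Psi>' - \<Phi>)"
    unfolding agree_on_def
  proof (intro allI ballI)
    fix Q1 h c x
    assume h: "h \<in> structure_sheaf (total_space L) Q1" "c \<in> matlas (lb_base L)"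
      and "x \<in> preim L s (Q' \<inter> Q1) \<inter> fst c"
    then have x: "x \<in> preim L s Q" "s x \<in> Q1" "x \<in> fst c"
      using r(3) by (auto simp: preim_def)
    show "(\<Psi> - \<Phi>) h c x = (\<Psi>' - \<Phi>) h c x"
      by (simp only: fun_diff_def agree_onD[OF assms(2) h x])
  qed
  from tensor_relations_cong[OF r(5) this] have "image_eq L s Q' \<Psi>' \<Phi>"
    unfolding image_eq_def .
  then show "\<exists>Q'. \<exists>\<Phi>\<in>form_operators L s Q'. q \<in> Q' \<and> Q' \<subseteq> Q \<and>
       (\<forall>c\<in>matlas (lb_base L). order_less (total_space L) s (nat (p + int dim_base + 1))
            (preim L s Q' \<inter> fst c) (\<lambda>h. \<Phi> h c)) \<and>
       image_eq L s Q' \<Psi>' \<Phi>"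
    by (intro exI[of _ Q'] bexI[OF _ r(1)] conjI r(2-4))
qed

text \<open>Locally \<Psi> is a low-order operator plus a relation. Composition with
  \<open>m\<close> lowers the order of the first by one and keeps the second a relation.\<close>

lemma hodge_filtration_comp_mult_vanishing:
  assumes m: "m \<in> structure_sheaf (total_space L) Q0" and Q: "Q \<subseteq> Q0"
    and van: "\<And>x. x \<in> preim L s Q0 \<Longrightarrow> m (s x) = 0"
    and p: "p + int dim_base + 1 \<ge> 0" and \<Psi>: "\<Psi> \<in> hodge_filtration L s (p + 1) Q"
  shows "\<Psi> \<circ> (\<lambda>h. m * h) \<in> hodge_filtration L s p Q"
proof (rule hodge_filtrationI)
  show "\<Psi> \<circ> (\<lambda>h. m * h) \<in> form_operators L s Q"
    by (rule form_operators_comp_mult[OF m hodge_filtration_form_operators[OF \<Psi>] Q])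
  \<comment> \<open>The function \<open>nat\<close> truncates at 0, so the bound for
    \<open>p + 1\<close> is the successor of the bound for \<open>p\<close> only under hypothesis
    \<open>p\<close>.\<close>
  have deg: "nat (p + 1 + int dim_base + 1) = Suc (nat (p + int dim_base + 1))"
    using p by simp
  fix q assume "q \<in> Q"
  with \<Psi> obtain Q' \<Phi> where r: "\<Phi> \<in> form_operators L s Q'" "q \<in> Q'" "Q' \<subseteq> Q"
    "\<forall>c\<in>matlas (lb_base L). order_less (total_space L) s (nat (p + 1 + int dim_base + 1))
            (preim L s Q' \<inter> fst c) (\<lambda>h. \<Phi> h c)"
    "\<Psi> - \<Phi> \<in> tensor_relations L s Q'"
    by (rule hodge_filtrationE)
  have Q': "Q' \<subseteq> Q0"
    using r(3) Q by blast
  have ord: "order_less (total_space L) s (nat (p + int dim_base + 1))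
      (preim L s Q' \<inter> fst c) (\<lambda>h. (\<Phi> \<circ> (\<lambda>h. m * h)) h c)" if c: "c \<in> matlas (lb_base L)" for c
  proof -
    have "s x \<in> Q0 \<and> m (s x) = 0" if "x \<in> preim L s Q' \<inter> fst c" for x
    proof -
      have "x \<in> preim L s Q0"
        using that Q' by (auto simp: preim_def)
      with van[OF this] show ?thesis
        by (simp add: preim_def)
    qed
    from order_less_comp_mult_vanishing[OF inj_charts_total m r(4)[unfolded deg, rule_format, OF c] this] show ?thesis
      unfolding comp_def .
  qed
  have "(\<Psi> \<circ> (\<lambda>h. m * h)) - (\<Phi> \<circ> (\<lambda>h. m * h)) = (\<Psi> - \<Phi>) \<circ> (\<lambda>h. m * h)"
    by (simp only: fun_diff_def comp_def)
  with tensor_relations_comp_mult[OF m r(5) Q']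
  have "image_eq L s Q' (\<Psi> \<circ> (\<lambda>h. m * h)) (\<Phi> \<circ> (\<lambda>h. m * h))"
    unfolding image_eq_def by (simp only:)
  then show "\<exists>Q'. \<exists>\<Phi>\<in>form_operators L s Q'. q \<in> Q' \<and> Q' \<subseteq> Q \<and>
       (\<forall>c\<in>matlas (lb_base L). order_less (total_space L) s (nat (p + int dim_base + 1))
            (preim L s Q' \<inter> fst c) (\<lambda>h. \<Phi> h c)) \<and>
       image_eq L s Q' (\<Psi> \<circ> (\<lambda>h. m * h)) \<Phi>"
    by (intro exI[of _ Q'] bexI[OF _ form_operators_comp_mult[OF m r(1) Q']] conjI r(2,3) ballI ord)
qed

section \<open>Derivatives along the fibres\<close>

text \<open>The inverse of the local trivialisation, in exactly the form that occurs in
  \<open>fibre_deriv\<close>; it parametrises the fibre over \<open>x\<close> by the complex number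
  \<open>w\<close>.\<close>

definition fibre_point :: "'a set \<Rightarrow> ('b \<Rightarrow> complex) \<Rightarrow> 'a \<Rightarrow> complex \<Rightarrow> 'b" where
  "fibre_point U \<tau> x w = inv_into (over L U) (\<lambda>q. (lb_proj L q, \<tau> q)) (x, w)"

lemma fibre_point:
  assumes "(U, \<tau>) \<in> lb_trivs L" "x \<in> U"
  shows "fibre_point U \<tau> x w \<in> over L U" "lb_proj L (fibre_point U \<tau> x w) = x"
    "\<tau> (fibre_point U \<tau> x w) = w"
proof -
  have im: "(x, w) \<in> (\<lambda>q. (lb_proj L q, \<tau> q)) ` over L U"
    using bij_betw_imp_surj_on[OF triv_bij[OF assms(1)]] assms(2) by simp
  show "fibre_point U \<tau> x w \<in> over L U"
    unfolding fibre_point_def by (rule inv_into_into[OF im])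
  show "lb_proj L (fibre_point U \<tau> x w) = x" "\<tau> (fibre_point U \<tau> x w) = w"
    using f_inv_into_f[OF im] unfolding fibre_point_def by simp_all
qed

lemma fibre_point_coordinate:
  assumes "(U, \<tau>) \<in> lb_trivs L" "p \<in> over L U"
  shows "fibre_point U \<tau> (lb_proj L p) (\<tau> p) = p"
proof (rule triv_inj[OF assms(1) _ assms(2)])
  have "lb_proj L p \<in> U"
    using assms(2) by (simp add: over_def)
  from fibre_point[OF assms(1) this]
  show "fibre_point U \<tau> (lb_proj L p) (\<tau> p) \<in> over L U"
    "lb_proj L (fibre_point U \<tau> (lb_proj L p) (\<tau> p)) = lb_proj L p"
    "\<tau> (fibre_point U \<tau> (lb_proj L p) (\<tau> p)) = \<tau> p"
    by simp_all
qed

text \<open>Differentiation along the fibres never leaves a fibre, so it becomes ordinary complex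
  differentiation in \<open>w\<close>. The induction keeps \<open>w\<close> general because the
  outer derivative uses the inner one as a function of \<open>w\<close>.\<close>

lemma funpow_fibre_deriv:
  assumes "(U, \<tau>) \<in> lb_trivs L" "x \<in> U"
  shows "(fibre_deriv L U \<tau> ^^ k) h (fibre_point U \<tau> x w) = (deriv ^^ k) (\<lambda>w. h (fibre_point U \<tau> x w)) w"
proof (induction k arbitrary: w)
  case 0
  show ?case by simp
next
  case (Suc k)
  have "(fibre_deriv L U \<tau> ^^ Suc k) h (fibre_point U \<tau> x w)
      = deriv (\<lambda>w. (fibre_deriv L U \<tau> ^^ k) h (fibre_point U \<tau> x w)) w"
    by (simp add: fibre_deriv_def fibre_point[OF assms] flip: fibre_point_def)
  then show ?case
    by (simp add: Suc.IH)
qed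

text \<open>In a chart of the total space the fibre is a coordinate line of direction
  \<open>dim_base\<close>, so separate holomorphy of \<open>h\<close> suffices. The base chart at
  \<open>x\<close> is there to provide such a chart.\<close>

lemma holomorphic_on_fibre:
  assumes T: "(U, \<tau>) \<in> lb_trivs L" and c: "(U0, \<phi>) \<in> matlas (lb_base L)" and x: "x \<in> U0 \<inter> U"
    and h: "h \<in> structure_sheaf (total_space L) Q"
  shows "open {w. fibre_point U \<tau> x w \<in> Q}"
    and "(\<lambda>w. h (fibre_point U \<tau> x w)) holomorphic_on {w. fibre_point U \<tau> x w \<in> Q}"
proof -
  let ?e = "fibre_point U \<tau> x" and ?A = "over L (U0 \<inter> U)" and ?\<psi> = "total_chart \<phi> \<tau>"
  let ?\<Omega> = "?\<psi> ` (?A \<inter> Q)"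
  have hol: "holomorphic_fun (Suc dim_base) ?\<Omega> (h \<circ> inv_into ?A ?\<psi>)"
    using h bspec[OF _ total_chart_mem[OF c T]] by (auto simp: structure_sheaf_def)
  then have op: "openin (complex_space (Suc dim_base)) ?\<Omega>"
    by (simp add: holomorphic_fun_iff)
  have xU: "x \<in> U"
    using x by simp
  have e: "?e w \<in> ?A" for w
    using fibre_point[OF T xU, of w] x by (simp add: over_def)
  have \<psi>: "?\<psi> (?e w) = (\<phi> x)(dim_base := w)" for w
    by (simp add: fibre_point[OF T xU])
  have inv: "inv_into ?A ?\<psi> ((\<phi> x)(dim_base := w)) = ?e w" for w
    unfolding \<psi>[symmetric] by (rule inv_into_f_f[OF total_chart_inj[OF c T] e])
  have mem: "(\<phi> x)(dim_base := w) \<in> ?\<Omega> \<longleftrightarrow> ?e w \<in> Q" for w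
    unfolding \<psi>[symmetric] using inj_on_image_mem_iff[OF total_chart_inj[OF c T] e, of "?A \<inter> Q"] e by simp
  have "\<forall>\<^sub>F w in nhds w0. ?e w \<in> Q" if "?e w0 \<in> Q" for w0
  proof -
    have "(\<phi> x)(dim_base := w0) \<in> ?\<Omega>"
      unfolding mem by (rule that)
    from openin_complex_space_coordinate[OF op this, of dim_base] show ?thesis
      by (simp only: fun_upd_upd mem fun_upd_same lessI)
  qed
  then have "\<exists>T. open T \<and> w0 \<in> T \<and> T \<subseteq> {w. ?e w \<in> Q}" if "w0 \<in> {w. ?e w \<in> Q}" for w0
    using that by (simp add: eventually_nhds subset_iff Ball_def)
  then show "open {w. ?e w \<in> Q}"
    by (rule iffD2[OF open_subopen, OF ballI])
  have "(\<lambda>w. h (?e w)) field_differentiable at w0" if "?e w0 \<in> Q" for w0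
  proof -
    have "(\<phi> x)(dim_base := w0) \<in> ?\<Omega>"
      unfolding mem by (rule that)
    from hol[unfolded holomorphic_fun_iff, THEN conjunct2, THEN conjunct2, rule_format, OF this lessI]
    show ?thesis
      by (simp only: fun_upd_upd fun_upd_same comp_def inv)
  qed
  then show "(\<lambda>w. h (?e w)) holomorphic_on {w. ?e w \<in> Q}"
    by (simp add: holomorphic_on_def field_differentiable_at_within)
qed

end

text \<open>In the Leibniz sum at \<open>c\<close> only the terms differentiating
  \<open>w - c\<close> exactly once survive: undifferentiated it vanishes at \<open>c\<close>, and
  its higher derivatives are zero. There are k + 1 ways to choose that derivative.\<close>

lemma higher_deriv_linear_factor:
  fixes u :: "complex \<Rightarrow> complex"
  assumes u: "u holomorphic_on S" and S: "open S" "c \<in> S"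
  shows "(deriv ^^ Suc k) (\<lambda>w. (w - c) * u w) c = of_nat (Suc k) * (deriv ^^ k) u c"
proof -
  have "deriv (\<lambda>w. w - c) = (\<lambda>w. 1)"
    by (rule ext) (auto intro!: DERIV_imp_deriv derivative_eq_intros)
  then have d: "(deriv ^^ i) (\<lambda>w. w - c) c = (if i = 1 then 1 else 0)" for i
    by (cases i) (simp_all add: funpow_Suc_right del: funpow.simps(2))
  have "(deriv ^^ Suc k) (\<lambda>w. (w - c) * u w) c = (\<Sum>i = 0..Suc k. of_nat (Suc k choose i) *
      (deriv ^^ i) (\<lambda>w. w - c) c * (deriv ^^ (Suc k - i)) u c)"
    by (rule higher_deriv_mult[OF _ u S]) (intro holomorphic_intros)
  also have "\<dots> = (\<Sum>i = 0..Suc k. if i = 1 then of_nat (Suc k choose i) * (deriv ^^ (Suc k - i)) u c else 0)"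
    unfolding d by (rule sum.cong[OF refl]) simp
  also have "\<dots> = of_nat (Suc k) * (deriv ^^ k) u c"
    by (subst sum.delta) simp_all
  finally show ?thesis .
qed

section \<open>The operator \<open>t - f\<close>\<close>

context line_bundle_on_manifold
begin

text \<open>This is \<open>a (t - f)\<close>, with \<open>f\<close> pulled back to the total space
  by the projection; the constant \<open>a\<close> is reserved for the normalisation.\<close>

definition normal_coordinate :: "('a \<Rightarrow> 'b) \<Rightarrow> ('b \<Rightarrow> complex) \<Rightarrow> complex \<Rightarrow> 'b \<Rightarrow> complex" where
  "normal_coordinate s \<tau> a p = a * (\<tau> p - \<tau> (s (lb_proj L p)))"

lemma normal_coordinate_structure_sheaf:
  assumes s: "holomorphic_section L s" and T: "(U, \<tau>) \<in> lb_trivs L"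
  shows "normal_coordinate s \<tau> a \<in> structure_sheaf (total_space L) (over L U)"
proof -
  have "\<tau> \<circ> s \<in> structure_sheaf (lb_base L) U"
    using s T unfolding holomorphic_section_def by blast
  from structure_sheaf_lincomb[OF structure_sheaf_fibre_coordinate[OF T] structure_sheaf_pullback[OF this],
      of a "- a"]
  show ?thesis
    by (simp add: normal_coordinate_def[abs_def] comp_def right_diff_distrib)
qed

lemma normal_coordinate_section:
  assumes "holomorphic_section L s" "x \<in> preim L s Q"
  shows "normal_coordinate s \<tau> a (s x) = 0"
  using assms by (simp add: normal_coordinate_def preim_def holomorphic_section_def)

lemma funpow_fibre_deriv_normal_coordinate:
  assumes s: "holomorphic_section L s" and T: "(U, \<tau>) \<in> lb_trivs L"
    and c: "(U0, \<phi>) \<in> matlas (lb_base L)" and x: "x \<in> U0 \<inter> U"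
    and h: "h \<in> structure_sheaf (total_space L) Q" and sx: "s x \<in> Q"
  shows "(fibre_deriv L U \<tau> ^^ Suc k) (normal_coordinate s \<tau> (1 / of_nat (Suc k)) * h) (s x)
    = (fibre_deriv L U \<tau> ^^ k) h (s x)"
proof -
  let ?e = "fibre_point U \<tau> x" and ?t = "\<tau> (s x)"
  let ?S = "{w. ?e w \<in> Q}" and ?u = "\<lambda>w. h (?e w)" and ?a = "1 / of_nat (Suc k) :: complex"
  have xU: "x \<in> U"
    using x by simp
  have sec: "s x \<in> topspace (lb_top L)" "lb_proj L (s x) = x"
    using s openin_subset[OF triv_open[OF T]] xU by (auto simp: holomorphic_section_def)
  then have e: "?e ?t = s x"
    using fibre_point_coordinate[OF T, of "s x"] xU by (simp add: over_def)
  have t: "?t \<in> ?S"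
    using sx by (simp add: e)
  note fibre = holomorphic_on_fibre[OF T c x h]
  have au: "(\<lambda>w. ?a * ?u w) holomorphic_on ?S"
    by (intro holomorphic_intros fibre(2))
  have "(fibre_deriv L U \<tau> ^^ Suc k) (normal_coordinate s \<tau> ?a * h) (?e ?t)
      = (deriv ^^ Suc k) (\<lambda>w. (normal_coordinate s \<tau> ?a * h) (?e w)) ?t"
    by (rule funpow_fibre_deriv[OF T xU])
  \<comment> \<open>The pulled-back \<open>f\<close> is constant along the fibre, so the multiplier
    becomes a linear factor vanishing exactly at the parameter of \<open>s x\<close>.\<close>
  also have "(\<lambda>w. (normal_coordinate s \<tau> ?a * h) (?e w)) = (\<lambda>w. (w - ?t) * (?a * ?u w))"
    by (rule ext) (simp add: normal_coordinate_def fibre_point[OF T xU])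
  also have "(deriv ^^ Suc k) (\<lambda>w. (w - ?t) * (?a * ?u w)) ?t = of_nat (Suc k) * (deriv ^^ k) (\<lambda>w. ?a * ?u w) ?t"
    by (rule higher_deriv_linear_factor[OF au fibre(1) t])
  also have "(deriv ^^ k) (\<lambda>w. ?a * ?u w) ?t = ?a * (deriv ^^ k) ?u ?t"
    by (rule higher_deriv_cmult[OF fibre(2) t fibre(1)])
  also have "(deriv ^^ k) ?u ?t = (fibre_deriv L U \<tau> ^^ k) h (?e ?t)"
    by (rule funpow_fibre_deriv[OF T xU, symmetric])
  finally have "(fibre_deriv L U \<tau> ^^ Suc k) (normal_coordinate s \<tau> ?a * h) (?e ?t)
      = of_nat (Suc k) * (?a * (fibre_deriv L U \<tau> ^^ k) h (?e ?t))" .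
  moreover have "of_nat (Suc k) * (?a * z) = z" for z
    by (simp del: of_nat_Suc)
  ultimately show ?thesis
    unfolding e by (simp only:)
qed

section \<open>Comparison of consecutive ideals\<close>

lemma V0_submodule_comp:
  assumes "V0_submodule L s N" "openin (lb_top L) Q" "\<Psi> \<in> N Q" "P \<in> V0_operators L Q"
  shows "\<Psi> \<circ> P \<in> N Q"
  by (rule assms(1)[unfolded V0_submodule_def, rule_format, OF assms(2), THEN conjunct2, THEN conjunct2,
        THEN conjunct2, THEN conjunct1, rule_format, OF assms(3,4)])

text \<open>A witness \<Psi> for \<open>g\<close> at level k + 1 yields the witness
  \<open>\<Psi> \<circ> m\<close> for the same \<open>g\<close> at level k, on the same
  neighbourhood of the point.\<close>

lemma multiplier_ideal_decreasing_on_chart: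
  assumes s: "holomorphic_section L s" and V: "V0_submodule L s (V \<alpha>)"
    and J: "is_higher_multiplier_ideal L s V k \<alpha> J"
    and J': "is_higher_multiplier_ideal L s V (Suc k) \<alpha> J'"
    and c: "c \<in> matlas (lb_base L)" and T: "T \<in> lb_trivs L"
    and W: "openin (mtop (lb_base L)) W" "W \<subseteq> fst c \<inter> fst T"
  shows "J' W \<subseteq> J W"
proof
  fix g assume "g \<in> J' W"
  obtain U0 \<phi> U \<tau> where cT: "c = (U0, \<phi>)" "T = (U, \<tau>)"
    by (metis prod.exhaust)
  let ?p = "int k - int dim_base" and ?p' = "int (Suc k) - int dim_base"
  have J_eq: "J W = {g \<in> structure_sheaf (lb_base L) W. \<forall>x\<in>W. \<exists>W'.
      openin (mtop (lb_base L)) W' \<and> x \<in> W' \<and> W' \<subseteq> W \<and>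
      (\<exists>\<Psi> \<in> hodge_filtration L s ?p (over L W') \<inter> V \<alpha> (over L W').
         \<Psi> - graded_section L s c T k g \<in> hodge_filtration L s (?p - 1) (over L W'))}"
    by (rule J[unfolded is_higher_multiplier_ideal_def, THEN conjunct2, rule_format, OF c T])
      (use W in simp)
  have J'_eq: "J' W = {g \<in> structure_sheaf (lb_base L) W. \<forall>x\<in>W. \<exists>W'.
      openin (mtop (lb_base L)) W' \<and> x \<in> W' \<and> W' \<subseteq> W \<and>
      (\<exists>\<Psi> \<in> hodge_filtration L s ?p' (over L W') \<inter> V \<alpha> (over L W').
         \<Psi> - graded_section L s c T (Suc k) g \<in> hodge_filtration L s (?p' - 1) (over L W'))}"
    by (rule J'[unfolded is_higher_multiplier_ideal_def, THEN conjunct2, rule_format, OF c T])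
      (use W in simp)
  define m where "m = normal_coordinate s \<tau> (1 / of_nat (Suc k))"
  have m: "m \<in> structure_sheaf (total_space L) (over L U)"
    unfolding m_def by (rule normal_coordinate_structure_sheaf[OF s T[unfolded cT]])
  have van: "m (s x) = 0" if "x \<in> preim L s (over L U)" for x
    unfolding m_def by (rule normal_coordinate_section[OF s that])
  \<comment> \<open>The last inequality amounts to k \<ge> 0. For k = 0 it is an equality: the error
    term then has a representative of order less than 0, that is, zero.\<close>
  have p: "?p' = ?p + 1" "?p' - 1 = (?p - 1) + 1" "?p + int dim_base + 1 \<ge> 0" "?p - 1 + int dim_base + 1 \<ge> 0"
    by simp_all
  have "\<exists>W'. openin (mtop (lb_base L)) W' \<and> x \<in> W' \<and> W' \<subseteq> W \<and>
      (\<exists>\<Psi> \<in> hodge_filtration L s ?p (over L W') \<inter> V \<alpha> (over L W').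
         \<Psi> - graded_section L s c T k g \<in> hodge_filtration L s (?p - 1) (over L W'))"
    if x: "x \<in> W" for x
  proof -
    obtain W' \<Psi> where W': "openin (mtop (lb_base L)) W'" "x \<in> W'" "W' \<subseteq> W"
      and \<Psi>: "\<Psi> \<in> hodge_filtration L s ?p' (over L W')" "\<Psi> \<in> V \<alpha> (over L W')"
        "\<Psi> - graded_section L s c T (Suc k) g \<in> hodge_filtration L s (?p' - 1) (over L W')"
      using \<open>g \<in> J' W\<close>[unfolded J'_eq mem_Collect_eq, THEN conjunct2, rule_format, OF x]
      by (elim exE conjE bexE IntE)
    have sub: "W' \<subseteq> U0" "W' \<subseteq> U"
      using W'(3) W(2) by (auto simp: cT)
    have over: "over L W' \<subseteq> over L U"
      by (rule over_mono[OF sub(2)])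
    let ?\<Phi> = "\<Psi> \<circ> (\<lambda>h. m * h)"
    have F: "?\<Phi> \<in> hodge_filtration L s ?p (over L W')"
      by (rule hodge_filtration_comp_mult_vanishing[OF m over van p(3) \<Psi>(1)[unfolded p(1)]])
    have V\<alpha>: "?\<Phi> \<in> V \<alpha> (over L W')"
      by (rule V0_submodule_comp[OF V openin_over[OF W'(1)] \<Psi>(2) mult_V0_operator[OF m W'(1) over]])
    have "(\<Psi> - graded_section L s c T (Suc k) g) \<circ> (\<lambda>h. m * h) \<in> hodge_filtration L s (?p - 1) (over L W')"
      by (rule hodge_filtration_comp_mult_vanishing[OF m over van p(4) \<Psi>(3)[unfolded p(2)]])
    \<comment> \<open>Composition distributes over the difference, so only the two leading terms
      remain to be compared.\<close>
    moreover have "agree_on s (over L W') ((\<Psi> - graded_section L s c T (Suc k) g) \<circ> (\<lambda>h. m * h))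
        (?\<Phi> - graded_section L s c T k g)"
      unfolding agree_on_def
    proof (intro allI ballI)
      fix Q h and c' :: "'a chart" and y
      assume h: "h \<in> structure_sheaf (total_space L) Q" and "y \<in> preim L s (over L W' \<inter> Q) \<inter> fst c'"
      then have y: "lb_proj L (s y) \<in> W'" "lb_proj L (s y) = y" "s y \<in> Q"
        using s by (auto simp: preim_def over_def holomorphic_section_def)
      then have "y \<in> U0 \<inter> U"
        using sub by auto
      \<comment> \<open>The chart \<open>c\<close> supplies holomorphy along the fibre, while the
        arbitrary chart \<open>c'\<close> enters only through a Jacobian factor common to both
        sides.\<close>
      from funpow_fibre_deriv_normal_coordinate[OF s T[unfolded cT] c[unfolded cT] this h y(3), of k]
      have "graded_section L s c T (Suc k) g (m * h) c' y = graded_section L s c T k g h c' y"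
        unfolding graded_section_def cT fst_conv snd_conv m_def by (simp only:)
      then show "((\<Psi> - graded_section L s c T (Suc k) g) \<circ> (\<lambda>h. m * h)) h c' y
          = (?\<Phi> - graded_section L s c T k g) h c' y"
        by (simp only: comp_def fun_diff_def)
    qed
    ultimately have "?\<Phi> - graded_section L s c T k g \<in> hodge_filtration L s (?p - 1) (over L W')"
      by (rule hodge_filtration_cong)
    then show ?thesis
      by (intro exI[of _ W'] bexI[of _ ?\<Phi>] conjI IntI W' F V\<alpha>)
  qed
  moreover have "g \<in> structure_sheaf (lb_base L) W"
    using \<open>g \<in> J' W\<close>[unfolded J'_eq mem_Collect_eq] by (rule conjunct1)
  ultimately show "g \<in> J W"
    unfolding J_eq mem_Collect_eq by (intro conjI ballI)
qed

end

text \<open>The gluing rule takes the given function itself as local section on each neighbourhood,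
  which is possible because sections are total functions.\<close>

lemma coherent_ideal_sheafD:
  assumes "coherent_ideal_sheaf X J" "openin (mtop X) W"
  shows "J W \<subseteq> structure_sheaf X W"
    and "openin (mtop X) W' \<Longrightarrow> W' \<subseteq> W \<Longrightarrow> J W \<subseteq> J W'"
    and "f \<in> structure_sheaf X W \<Longrightarrow>
      (\<And>x. x \<in> W \<Longrightarrow> \<exists>W'. openin (mtop X) W' \<and> x \<in> W' \<and> W' \<subseteq> W \<and> f \<in> J W') \<Longrightarrow> f \<in> J W"
proof -
  note J = assms(1)[unfolded coherent_ideal_sheaf_def, THEN conjunct1, rule_format, OF assms(2)]
  show "J W \<subseteq> structure_sheaf X W"
    by (rule J[THEN conjunct1])
  show "J W \<subseteq> J W'" if "openin (mtop X) W'" "W' \<subseteq> W"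
    using J that by blast
  show "f \<in> J W" if f: "f \<in> structure_sheaf X W"
    and loc: "\<And>x. x \<in> W \<Longrightarrow> \<exists>W'. openin (mtop X) W' \<and> x \<in> W' \<and> W' \<subseteq> W \<and> f \<in> J W'"
  proof -
    have "\<forall>x\<in>W. \<exists>W' g. openin (mtop X) W' \<and> x \<in> W' \<and> W' \<subseteq> W \<and> g \<in> J W' \<and> fun_eq_on W' f g"
      using loc unfolding fun_eq_on_def by blast
    with J f show ?thesis
      by blast
  qed
qed

theorem corollary3p9:
  fixes X :: "'a cmanifold"
    and D :: "('a set \<times> ('a \<Rightarrow> complex)) set"
    and L :: "('a, 'b) line_bundle"
    and s :: "'a \<Rightarrow> 'b"
    and V :: "rat \<Rightarrow> 'b set \<Rightarrow> ('a, 'b) form_operator set"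
    and \<I> :: "nat \<Rightarrow> rat \<Rightarrow> 'a set \<Rightarrow> ('a \<Rightarrow> complex) set"
  assumes "complex_manifold X"
    and "effective_divisor X D"
    and "holomorphic_line_bundle L" and "lb_base L = X"
    and "holomorphic_section L s" and "has_divisor L s D"
    and "kashiwara_malgrange_filtration L s V"
    and "\<And>k \<alpha>. is_higher_multiplier_ideal L s V k \<alpha> (\<I> k \<alpha>)"
  shows "\<forall>\<alpha> k W. openin (mtop X) W \<longrightarrow> \<I> (k + 1) \<alpha> W \<subseteq> \<I> k \<alpha> W"
proof (intro allI impI subsetI)
  fix \<alpha> k W f assume W: "openin (mtop X) W" and f: "f \<in> \<I> (k + 1) \<alpha> W"
  interpret line_bundle_on_manifold L
    using assms(1,3,4) by unfold_locales simp_all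
  have J: "coherent_ideal_sheaf X (\<I> j \<alpha>)" for j
    using assms(8)[of j \<alpha>] unfolding is_higher_multiplier_ideal_def assms(4) by (rule conjunct1)
  have V: "V0_submodule L s (V \<alpha>)"
    by (rule assms(7)[unfolded kashiwara_malgrange_filtration_def, THEN conjunct1, rule_format, THEN conjunct1])
  show "f \<in> \<I> k \<alpha> W"
  proof (rule coherent_ideal_sheafD(3)[OF J W])
    show "f \<in> structure_sheaf X W"
      using coherent_ideal_sheafD(1)[OF J W] f by blast
    fix x assume x: "x \<in> W"
    then have "x \<in> topspace (mtop X)"
      using openin_subset[OF W] by blast
    moreover have "(\<Union>(U, \<phi>)\<in>matlas X. U) = topspace (mtop X)"
      using assms(1) by (simp add: complex_manifold_def)
    moreover have "(\<Union>(U, \<tau>)\<in>lb_trivs L. U) = topspace (mtop X)"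
      using assms(3) by (simp add: holomorphic_line_bundle_def assms(4))
    ultimately obtain U \<phi> U' \<tau> where c: "(U, \<phi>) \<in> matlas X" "(U', \<tau>) \<in> lb_trivs L" "x \<in> U" "x \<in> U'"
      by blast
    \<comment> \<open>The ideals are described explicitly only inside a chart and a trivialisation;
      the rest of \<open>W\<close> is reached by restricting to this set and gluing.\<close>
    let ?W = "U \<inter> U' \<inter> W"
    have W': "openin (mtop X) ?W"
      using openin_chart_triv[of U \<phi> U' \<tau> W] c W by (simp add: assms(4))
    have "\<I> (Suc k) \<alpha> ?W \<subseteq> \<I> k \<alpha> ?W"
      by (rule multiplier_ideal_decreasing_on_chart[OF assms(5) V assms(8) assms(8), unfolded assms(4),
            OF c(1,2) W']) auto
    moreover have "f \<in> \<I> (Suc k) \<alpha> ?W"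
      using coherent_ideal_sheafD(2)[OF J W W', of "Suc k"] f by auto
    ultimately show "\<exists>W'. openin (mtop X) W' \<and> x \<in> W' \<and> W' \<subseteq> W \<and> f \<in> \<I> k \<alpha> W'"
      using W' x c(3,4) by blast
  qed
qed

end
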